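(* Let $\Gamma$ be a planar straight-line grid drawing of a plane graph $G$. If $\Gamma$ is liftable, then its transformed drawing $\Gamma_f$ with respect to a lifting function $f:\mathbb{R}\to\mathbb{R}$ is a planar straight-line grid drawing of $G$ with the same planar embedding as $\Gamma$.
   Context: A plane graph is a graph with a prescribed planar embedding. A straight-line drawing maps vertices to distinct points of the plane and each edge to the straight-line segment between its endpoints; it is planar if two edges meet only at common endpoints and no edge passes through a vertex that is not one of its endpoints. It is a grid drawing if its vertices are on an integer grid, i.e., have integer coordinates. Write $(x_u,y_u)$ for the coordinates of vertex $u$ in $\Gamma$. Transformed drawing: given a drawing $\Gamma$ and a function $f:\mathbb{R}\to\mathbb{R}$, the transformed drawing $\Gamma_f$ of $\Gamma$ with respect to $f$ is the straight-line drawing obtained by applying the transformation $(x_u,y_u)\mapsto(x_u,f(y_u))$ to the vertices of $\Gamma$. Lifting function: $f:\mathbb{R}\to\mathbb{R}$ is lifting if and only if (i) $f$ is strictly-convex (that is, $f(ta+(1-t)b)<tf(a)+(1-t)f(b)$ for all $t$ with $0<t<1$ and all real $a\neq b$) and strictly-increasing (that is, $f(a)<f(b)$ whenever $a<b$); (ii) $f(r)\ge r$ for all $r\in\mathbb{R}$; (iii) $r\in\mathbb{N}$ implies $f(r)\in\mathbb{N}$, where $\mathbb{N}$ denotes the natural numbers. Triangle $\Delta_{uv}$: for two vertices $u,v$ of $\Gamma$, $\Delta_{uv}$ is the interior of the right triangle whose corners are $u$, $v$ and the intersection of the vertical line through the vertex having the lowest $y$-coordinate with the horizontal line through the vertex having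 the highest $y$-coordinate (among $u,v$). If $u$ and $v$ are vertically or horizontally aligned, this triangle is degenerate and $\Delta_{uv}=\emptyset$. Liftable drawing: a planar straight-line grid drawing of a graph $G$ is liftable if for every edge $(u,v)$ of $G$ there is no vertex of $G$ in $\Delta_{uv}$. Two planar drawings of the same graph have the same planar embedding if they have the same circular order of edges around each vertex and the same outer face.
   Formalization: That the transformed drawing is a grid drawing is claimed only when all vertices of Γ have non-negative y-coordinates; a lifting function need not send negative integers to integers, e.g. f(r)=r²+r for r≥0, f(r)=exp(r)−1 for r<0, with a vertex at (0,−1). *)

theory Defs
  imports "HOL-Analysis.Analysis"
begin

definition simple_graph :: "'v set \<Rightarrow> 'v set set \<Rightarrow> bool" where
  "simple_graph V E \<longleftrightarrow> finite V \<and> (\<forall>e\<in>E. e \<subseteq> V \<and> card e = 2)"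

text \<open>
  The plane is the type of complex numbers: the coordinates of a vertex \<open>u\<close> are
  \<open>Re (\<Gamma> u)\<close> and \<open>Im (\<Gamma> u)\<close>. A straight-line drawing is determined by its vertex positions.
\<close>

type_synonym 'v drawing = "'v \<Rightarrow> complex"

definition edge_segment :: "'v drawing \<Rightarrow> 'v set \<Rightarrow> complex set" where
  "edge_segment \<Gamma> e = convex hull (\<Gamma> ` e)"

definition planar_straight_line_drawing :: "'v set \<Rightarrow> 'v set set \<Rightarrow> 'v drawing \<Rightarrow> bool" where
  "planar_straight_line_drawing V E \<Gamma> \<longleftrightarrow>
     inj_on \<Gamma> V \<and>
     (\<forall>e\<in>E. \<forall>e'\<in>E. e \<noteq> e' \<longrightarrow> edge_segment \<Gamma> e \<inter> edge_segment \<Gamma> e' \<subseteq> \<Gamma> ` (e \<inter> e')) \<and>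
     (\<forall>e\<in>E. \<forall>w\<in>V - e. \<Gamma> w \<notin> edge_segment \<Gamma> e)"

definition grid_drawing :: "'v set \<Rightarrow> 'v drawing \<Rightarrow> bool" where
  "grid_drawing V \<Gamma> \<longleftrightarrow> (\<forall>u\<in>V. Re (\<Gamma> u) \<in> \<int> \<and> Im (\<Gamma> u) \<in> \<int>)"

definition transformed_drawing :: "(real \<Rightarrow> real) \<Rightarrow> 'v drawing \<Rightarrow> 'v drawing" where
  "transformed_drawing f \<Gamma> = (\<lambda>u. Complex (Re (\<Gamma> u)) (f (Im (\<Gamma> u))))"

definition strictly_convex :: "(real \<Rightarrow> real) \<Rightarrow> bool" where
  "strictly_convex f \<longleftrightarrow>
     (\<forall>a b t. 0 < t \<and> t < 1 \<and> a \<noteq> b \<longrightarrow>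
        f (t * a + (1 - t) * b) < t * f a + (1 - t) * f b)"

definition lifting_function :: "(real \<Rightarrow> real) \<Rightarrow> bool" where
  "lifting_function f \<longleftrightarrow>
     strictly_convex f \<and> strict_mono f \<and> (\<forall>r. f r \<ge> r) \<and> (\<forall>r\<in>\<nat>. f r \<in> \<nat>)"

text \<open>
  If the two points are vertically or horizontally aligned, the corner coincides with one of
  them, so the hull is a segment and its interior is empty. When the heights are equal, either
  point may serve as the lower one.
\<close>

definition triangle_corner :: "complex \<Rightarrow> complex \<Rightarrow> complex" where
  "triangle_corner p q =
     (if Im p \<le> Im q then Complex (Re p) (Im q) else Complex (Re q) (Im p))"

definition lift_triangle :: "'v drawing \<Rightarrow> 'v \<Rightarrow> 'v \<Rightarrow> complex set" where
  "lift_triangle \<Gamma> u v =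
     interior (convex hull {\<Gamma> u, \<Gamma> v, triangle_corner (\<Gamma> u) (\<Gamma> v)})"

definition liftable :: "'v set \<Rightarrow> 'v set set \<Rightarrow> 'v drawing \<Rightarrow> bool" where
  "liftable V E \<Gamma> \<longleftrightarrow>
     planar_straight_line_drawing V E \<Gamma> \<and> grid_drawing V \<Gamma> \<and>
     (\<forall>u v. {u, v} \<in> E \<longrightarrow> (\<forall>w\<in>V. \<Gamma> w \<notin> lift_triangle \<Gamma> u v))"

text \<open>
  The circular order of the edges at a vertex \<open>v\<close>, as a ternary relation: \<open>(v, a, b, c)\<close> belongs
  to the relation iff, turning counterclockwise around \<open>v\<close> from the edge \<open>va\<close>, the edge \<open>vb\<close> is met
  before the edge \<open>vc\<close>. In a planar drawing distinct edges at \<open>v\<close> have distinct directions.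
\<close>

definition circular_order :: "'v set set \<Rightarrow> 'v drawing \<Rightarrow> ('v \<times> 'v \<times> 'v \<times> 'v) set" where
  "circular_order E \<Gamma> =
     {(v, a, b, c). {v, a} \<in> E \<and> {v, b} \<in> E \<and> {v, c} \<in> E \<and> distinct [a, b, c] \<and>
        Arg2pi ((\<Gamma> b - \<Gamma> v) / (\<Gamma> a - \<Gamma> v)) < Arg2pi ((\<Gamma> c - \<Gamma> v) / (\<Gamma> a - \<Gamma> v))}"

definition drawing_points :: "'v set \<Rightarrow> 'v set set \<Rightarrow> 'v drawing \<Rightarrow> complex set" where
  "drawing_points V E \<Gamma> = \<Gamma> ` V \<union> (\<Union>e\<in>E. edge_segment \<Gamma> e)"

definition outer_region :: "'v set \<Rightarrow> 'v set set \<Rightarrow> 'v drawing \<Rightarrow> complex set" where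
  "outer_region V E \<Gamma> = outside (drawing_points V E \<Gamma>)"

text \<open>
  To compare the outer faces of two drawings, the outer face is described by its incidences: the
  vertices on its boundary, and the directed edges along which it lies locally on the left (the
  boundary walk of the face, traversed with the face on the left). Recording the side
  distinguishes, e.g., the two faces of a cycle, whose boundaries consist of the same edges.
  Multiplication by \<open>\<i>\<close> is the counterclockwise quarter turn.
\<close>

definition outer_vertices :: "'v set \<Rightarrow> 'v set set \<Rightarrow> 'v drawing \<Rightarrow> 'v set" where
  "outer_vertices V E \<Gamma> = {v \<in> V. \<Gamma> v \<in> frontier (outer_region V E \<Gamma>)}"

definition outer_sides :: "'v set \<Rightarrow> 'v set set \<Rightarrow> 'v drawing \<Rightarrow> ('v \<times> 'v) set" where
  "outer_sides V E \<Gamma> =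
     {(u, v). {u, v} \<in> E \<and>
        (\<forall>z\<in>open_segment (\<Gamma> u) (\<Gamma> v).
           \<forall>\<^sub>F d in at_right (0::real).
             z + of_real d * (\<i> * (\<Gamma> v - \<Gamma> u)) \<in> outer_region V E \<Gamma>)}"

record 'v plane_embedding =
  rotations :: "('v \<times> 'v \<times> 'v \<times> 'v) set"
  outer_face_vertices :: "'v set"
  outer_face_sides :: "('v \<times> 'v) set"

definition embedding_of :: "'v set \<Rightarrow> 'v set set \<Rightarrow> 'v drawing \<Rightarrow> 'v plane_embedding" where
  "embedding_of V E \<Gamma> =
     \<lparr> rotations = circular_order E \<Gamma>,
       outer_face_vertices = outer_vertices V E \<Gamma>,
       outer_face_sides = outer_sides V E \<Gamma> \<rparr>"

definition same_planar_embedding ::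
    "'v set \<Rightarrow> 'v set set \<Rightarrow> 'v drawing \<Rightarrow> 'v drawing \<Rightarrow> bool" where
  "same_planar_embedding V E \<Gamma> \<Gamma>' \<longleftrightarrow> embedding_of V E \<Gamma> = embedding_of V E \<Gamma>'"

text \<open>
  A plane graph \<open>(V, E, \<E>)\<close> is a graph with a prescribed planar embedding \<open>\<E>\<close>, and a drawing of it
  has to realise \<open>\<E>\<close>. That \<open>\<E>\<close> is the embedding of some planar drawing is not assumed
  separately, since any drawing of the plane graph witnesses it.
\<close>

definition planar_drawing_of_plane_graph ::
    "'v set \<Rightarrow> 'v set set \<Rightarrow> 'v plane_embedding \<Rightarrow> 'v drawing \<Rightarrow> bool" where
  "planar_drawing_of_plane_graph V E \<E> \<Gamma> \<longleftrightarrow>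
     simple_graph V E \<and> planar_straight_line_drawing V E \<Gamma> \<and> embedding_of V E \<Gamma> = \<E>"

end

theory Submission
  imports Defs
begin

text \<open>
  Interpolate: with \<open>f\<^sub>t(y) = (1 - t) y + t f(y)\<close> the transformed drawings \<open>\<Gamma>\<^sub>t\<close> with
  respect to \<open>f\<^sub>t\<close> move \<open>\<Gamma>\<close> continuously to \<open>\<Gamma>\<^sub>f\<close>. Each
  \<open>f\<^sub>t\<close> with \<open>t > 0\<close> is strictly convex and strictly increasing, so a vertex lying on a
  transformed edge \<open>uv\<close> would originally lie on the edge or inside the triangle \<open>\<Delta>\<^sub>u\<^sub>v\<close>; hence no
  vertex ever meets an edge, and all \<open>\<Gamma>\<^sub>t\<close> are planar. Along such a motion edges at a vertex never
  align, which fixes the circular orders. For the outer face, a point \<open>p\<^sub>t\<close> that moves without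
  meeting the drawing stays inside or stays outside: by Borsuk, \<open>p\<^sub>t\<close> is outside iff
  \<open>x \<mapsto> (x - p\<^sub>t) / |x - p\<^sub>t|\<close> is null-homotopic on the drawing, and the motion supplies a
  homotopy between these maps. Points slightly to the left of an edge are such points.
\<close>

section \<open>Points outside a moving compact set\<close>

text \<open>Since \<open>p 1\<close> is outside \<open>T\<close>, its Borsuk map on \<open>T\<close>
  is null-homotopic, hence so is its composite with \<open>h (1, _)\<close>. Moving the centre along
  \<open>p\<close> and the points along \<open>h\<close> joins this composite to the Borsuk map of
  \<open>S\<close> about \<open>p 0\<close>, and Borsuk's criterion is read backwards there.\<close>

lemma outside_moving_point:
  fixes h :: "real \<times> 'a::euclidean_space \<Rightarrow> 'a" and p :: "real \<Rightarrow> 'a"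
  assumes S: "compact S" and T: "compact T"
    and h: "continuous_on ({0..1} \<times> S) h"
    and h0: "\<And>x. x \<in> S \<Longrightarrow> h (0, x) = x"
    and h1: "\<And>x. x \<in> S \<Longrightarrow> h (1, x) \<in> T"
    and p: "continuous_on {0..1} p"
    and avoid: "\<And>t x. t \<in> {0..1} \<Longrightarrow> x \<in> S \<Longrightarrow> h (t, x) \<noteq> p t"
    and out: "p 1 \<in> outside T"
  shows "p 0 \<in> outside S"
proof -
  \<comment> \<open>\<open>b a\<close> is the Borsuk map: the radial projection from
    \<open>a\<close> onto the unit sphere.\<close>
  define b where "b = (\<lambda>a x. inverse (norm (x - a)) *\<^sub>R (x - a :: 'a))"
  have p0: "p 0 \<notin> S"
    using avoid[of 0] h0 by force
  have "p 1 \<notin> T" "\<not> bounded (connected_component_set (- T) (p 1))"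
    using out by (auto simp: outside_def)
  then obtain c where c: "homotopic_with_canon (\<lambda>x. True) T (sphere 0 1) (b (p 1)) (\<lambda>x. c)"
    using Borsuk_map_essential_bounded_component[OF T] unfolding b_def by blast
  have "continuous_on S (\<lambda>x. h (1, x))"
    by (rule continuous_on_compose2[OF h]) (auto intro!: continuous_intros)
  then have c': "homotopic_with_canon (\<lambda>x. True) S (sphere 0 1) (\<lambda>x. b (p 1) (h (1, x))) (\<lambda>x. c)"
    using homotopic_with_compose_continuous_right[OF c, of S "\<lambda>x. h (1, x)"] h1
    by (auto simp: o_def)
  have pt: "continuous_on ({0..1} \<times> S) (\<lambda>z. p (fst z))"
    by (rule continuous_on_compose2[OF p]) (auto intro!: continuous_intros)
  \<comment> \<open>The homotopy is \<open>b (p t) (h (t, x))\<close>; by \<open>avoid\<close> its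
    argument never equals the centre of projection.\<close>
  have "homotopic_with_canon (\<lambda>x. True) S (sphere 0 1) (b (p 0)) (\<lambda>x. b (p 1) (h (1, x)))"
  proof (subst homotopic_with, simp, intro exI conjI ballI)
    show "continuous_map (prod_topology (top_of_set {0..1}) (top_of_set S)) (top_of_set (sphere 0 1))
            (\<lambda>z. b (p (fst z)) (h z))"
      using avoid
      by (auto simp: b_def intro!: continuous_intros h pt)
  qed (auto simp: h0)
  then have "homotopic_with_canon (\<lambda>x. True) S (sphere 0 1) (b (p 0)) (\<lambda>x. c)"
    using c' by (rule homotopic_with_trans)
  then have "\<not> bounded (connected_component_set (- S) (p 0))"
    using Borsuk_map_essential_bounded_component[OF S p0] unfolding b_def by blast
  then show ?thesis
    using p0 by (simp add: outside_def)
qed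

section \<open>Points on edges\<close>

text \<open>Treating a vertex as a degenerate edge lets planarity be stated as a single condition.\<close>

definition cells :: "'v set \<Rightarrow> 'v set set \<Rightarrow> 'v set set" where
  "cells V E = E \<union> (\<lambda>v. {v}) ` V"

text \<open>The parameter is kept explicit so that the same relative position on an edge can be
  followed through different drawings.\<close>

definition edge_point :: "'v drawing \<Rightarrow> 'v \<Rightarrow> 'v \<Rightarrow> real \<Rightarrow> complex" where
  "edge_point \<Gamma> a b s = (1 - s) *\<^sub>R \<Gamma> a + s *\<^sub>R \<Gamma> b"

lemma edge_point_0 [simp]: "edge_point \<Gamma> a b 0 = \<Gamma> a"
  and edge_point_1 [simp]: "edge_point \<Gamma> a b 1 = \<Gamma> b"
  and edge_point_refl [simp]: "edge_point \<Gamma> a a s = \<Gamma> a"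
  by (simp_all add: edge_point_def flip: scaleR_left_distrib)

lemma edge_point_flip: "edge_point \<Gamma> b a s = edge_point \<Gamma> a b (1 - s)"
  by (simp add: edge_point_def)

lemma edge_point_inj:
  assumes "\<Gamma> a \<noteq> \<Gamma> b" "edge_point \<Gamma> a b s = edge_point \<Gamma> a b r"
  shows "s = r"
proof -
  have "(s - r) *\<^sub>R (\<Gamma> b - \<Gamma> a) = 0"
    using assms(2) by (simp add: edge_point_def algebra_simps)
  then show ?thesis
    using assms(1) by simp
qed

lemma edge_segment_pair: "edge_segment \<Gamma> {a, b} = edge_point \<Gamma> a b ` {0..1}"
  by (auto simp: edge_segment_def segment_convex_hull[symmetric] in_segment edge_point_def)

lemma edge_segment_eq_closed_segment: "edge_segment \<Gamma> {a, b} = closed_segment (\<Gamma> a) (\<Gamma> b)"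
  by (simp add: edge_segment_def segment_convex_hull)

lemma edge_segment_singleton [simp]: "edge_segment \<Gamma> {v} = {\<Gamma> v}"
  by (simp add: edge_segment_def)

lemma compact_edge_segment: "finite e \<Longrightarrow> compact (edge_segment \<Gamma> e)"
  by (simp add: edge_segment_def finite_imp_compact compact_convex_hull)

lemma finite_edges: "simple_graph V E \<Longrightarrow> finite E"
  unfolding simple_graph_def by (meson Pow_iff finite_Pow_iff finite_subset subsetI)

lemma finite_cells: "simple_graph V E \<Longrightarrow> finite (cells V E)"
  using finite_edges by (auto simp: cells_def simple_graph_def)

lemma edge_pair:
  assumes "simple_graph V E" "e \<in> E"
  obtains a b where "e = {a, b}" "a \<in> V" "b \<in> V" "a \<noteq> b"
  using assms unfolding simple_graph_def by (metis card_2_iff insert_subset)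

lemma edge_pairD:
  assumes "simple_graph V E" "{a, b} \<in> E"
  shows "a \<in> V" "b \<in> V" "a \<noteq> b"
  using assms by (auto simp: simple_graph_def)

lemma cell_pair:
  assumes "simple_graph V E" "e \<in> cells V E"
  obtains a b where "e = {a, b}" "a \<in> V" "b \<in> V"
proof (cases "e \<in> E")
  case True
  then show ?thesis
    using edge_pair[OF assms(1)] that by metis
next
  case False
  then obtain v where "v \<in> V" "e = {v}"
    using assms(2) by (auto simp: cells_def)
  then show ?thesis
    using that[of v v] by simp
qed

lemma cell_pairD:
  assumes "simple_graph V E" "{a, b} \<in> cells V E"
  shows "a \<in> V" "b \<in> V"
  using assms by (auto simp: simple_graph_def cells_def)

lemma drawing_points_cells: "drawing_points V E \<Gamma> = (\<Union>e\<in>cells V E. edge_segment \<Gamma> e)"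
  by (auto simp: drawing_points_def cells_def)

lemma compact_cell: "simple_graph V E \<Longrightarrow> e \<in> cells V E \<Longrightarrow> compact (edge_segment \<Gamma> e)"
  by (metis cell_pair compact_edge_segment finite.emptyI finite_insert)

lemma compact_drawing_points: "simple_graph V E \<Longrightarrow> compact (drawing_points V E \<Gamma>)"
  unfolding drawing_points_cells by (intro compact_UN finite_cells compact_cell)

lemma planar_injD:
  assumes "planar_straight_line_drawing V E \<Gamma>" "a \<in> V" "b \<in> V" "\<Gamma> a = \<Gamma> b"
  shows "a = b"
  using assms by (auto simp: planar_straight_line_drawing_def dest: inj_onD)

lemma planar_cells:
  assumes sg: "simple_graph V E" and pl: "planar_straight_line_drawing V E \<Gamma>"
    and e: "e \<in> cells V E" "e' \<in> cells V E" "e \<noteq> e'"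
  shows "edge_segment \<Gamma> e \<inter> edge_segment \<Gamma> e' \<subseteq> \<Gamma> ` (e \<inter> e')"
proof -
  have *: "edge_segment \<Gamma> e \<inter> {\<Gamma> v} \<subseteq> \<Gamma> ` (e \<inter> {v})" if "e \<in> E" "v \<in> V" for e v
    using pl that unfolding planar_straight_line_drawing_def by (cases "v \<in> e") auto
  consider "e \<in> E" "e' \<in> E" | v where "e \<in> E" "v \<in> V" "e' = {v}" | v where "e' \<in> E" "v \<in> V" "e = {v}"
    | v w where "v \<in> V" "w \<in> V" "e = {v}" "e' = {w}"
    using e by (auto simp: cells_def)
  then show ?thesis
  proof cases
    case 1
    then show ?thesis
      using pl e(3) by (auto simp: planar_straight_line_drawing_def)
  next
    case 2
    then show ?thesis using * by simp
  next
    case 3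
    then show ?thesis using *[of e' v] by (simp add: Int_commute)
  next
    case 4
    then show ?thesis using planar_injD[OF pl] e(3) by auto
  qed
qed

text \<open>This makes "same parameter on the same edge" a function from the points of
  \<open>\<Gamma>\<close> to those of any \<open>\<Delta>\<close>. In a planar drawing a point has
  two descriptions only if it is a common vertex of two cells or its edge is read in both
  directions.\<close>

lemma edge_point_well_defined:
  assumes sg: "simple_graph V E" and pl: "planar_straight_line_drawing V E \<Gamma>"
    and ab: "{a, b} \<in> cells V E" and cd: "{c, d} \<in> cells V E"
    and s: "s \<in> {0..1}" and r: "r \<in> {0..1}"
    and eq: "edge_point \<Gamma> a b s = edge_point \<Gamma> c d r"
  shows "edge_point \<Delta> a b s = edge_point \<Delta> c d r"
proof -
  note inj = planar_injD[OF pl]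
  have V: "a \<in> V" "b \<in> V" "c \<in> V" "d \<in> V"
    using cell_pairD[OF sg] ab cd by auto
  \<comment> \<open>On a nondegenerate cell only the parameters 0 and 1 reach an end, and these
    reach the corresponding end in every drawing.\<close>
  have vertex: "edge_point \<Delta> i j t = \<Delta> k"
    if "edge_point \<Gamma> i j t = \<Gamma> k" "k \<in> {i, j}" "i \<in> V" "j \<in> V" for i j k t
  proof (cases "i = j")
    case True
    then show ?thesis using that by auto
  next
    case False
    then have ne: "\<Gamma> i \<noteq> \<Gamma> j" using inj that by blast
    show ?thesis
    proof (cases "k = i")
      case True
      then have "t = 0" using edge_point_inj[of \<Gamma> i j t 0] ne that by simp
      then show ?thesis using True by simp
    next
      case False
      then have "t = 1" using edge_point_inj[of \<Gamma> i j t 1] ne that by auto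
      then show ?thesis using False that by auto
    qed
  qed
  show ?thesis
  proof (cases "{a, b} = {c, d}")
    case False
    have "edge_point \<Gamma> a b s \<in> edge_segment \<Gamma> {a, b} \<inter> edge_segment \<Gamma> {c, d}"
      unfolding edge_segment_pair using s r by (simp add: eq) (use eq in force)
    then obtain k where k: "k \<in> {a, b} \<inter> {c, d}" "edge_point \<Gamma> a b s = \<Gamma> k"
      using planar_cells[OF sg pl ab cd False] by blast
    then show ?thesis
      using vertex[of a b s k] vertex[of c d r k] V eq by simp
  next
    case True
    show ?thesis
    proof (cases "a = b")
      case True
      then show ?thesis using \<open>{a, b} = {c, d}\<close> by auto
    next
      case False
      then have ne: "\<Gamma> a \<noteq> \<Gamma> b" using inj V by blast
      from True consider "c = a" "d = b" | "c = b" "d = a" by (auto simp: doubleton_eq_iff)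
      then show ?thesis
      proof cases
        case 1
        then show ?thesis using edge_point_inj[of \<Gamma> a b s r] ne eq by blast
      next
        case 2
        then have "s = 1 - r"
          using edge_point_inj[of \<Gamma> a b s "1 - r"] ne eq 2 by (simp add: edge_point_flip[of \<Gamma> b a])
        then show ?thesis
          using 2 by (simp add: edge_point_flip[of \<Delta> b a])
      qed
    qed
  qed
qed

lemma continuous_on_edge_point:
  assumes "continuous_on S (\<lambda>t. G t a)" "continuous_on S (\<lambda>t. G t b)" "continuous_on S s"
  shows "continuous_on S (\<lambda>t. edge_point (G t) a b (s t))"
  unfolding edge_point_def by (intro continuous_intros assms)

section \<open>Moving drawings\<close>

text \<open>Planarity is left to \<open>planar_motion\<close>, because planarity at later times is
  itself deduced from a motion in \<open>planar_motionI\<close>.\<close>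

locale vertex_motion =
  fixes V :: "'v set" and E :: "'v set set" and G :: "real \<Rightarrow> 'v drawing"
  assumes graph: "simple_graph V E"
    and cont: "v \<in> V \<Longrightarrow> continuous_on {0..1} (\<lambda>t. G t v)"
begin

lemma cont_fst:
  assumes "v \<in> V"
  shows "continuous_on ({0..1} \<times> S) (\<lambda>z. G (fst z) v)"
  by (rule continuous_on_compose2[OF cont[OF assms]]) (auto intro!: continuous_intros)

text \<open>Planarity at time 0 makes \<open>h\<close> single-valued. Its continuity is checked on
  each of the finitely many closed sets \<open>{0..1} \<times> edge_segment (G 0) e\<close> and then
  glued.\<close>

lemma transport:
  assumes pl: "planar_straight_line_drawing V E (G 0)"
  obtains h where "continuous_on ({0..1} \<times> drawing_points V E (G 0)) h"
    and "\<And>t a b s. {a, b} \<in> cells V E \<Longrightarrow> s \<in> {0..1} \<Longrightarrow>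
           h (t, edge_point (G 0) a b s) = edge_point (G t) a b s"
proof -
  define h where "h = (\<lambda>(t, x). SOME y. \<exists>a b s. {a, b} \<in> cells V E \<and> s \<in> {0..1} \<and>
      x = edge_point (G 0) a b s \<and> y = edge_point (G t) a b s)"
  have h: "h (t, edge_point (G 0) a b s) = edge_point (G t) a b s"
    if "{a, b} \<in> cells V E" "s \<in> {0..1}" for t a b s
    unfolding h_def prod.case
  proof (rule some_equality)
    show "\<exists>a' b' s'. {a', b'} \<in> cells V E \<and> s' \<in> {0..1} \<and> edge_point (G 0) a b s = edge_point (G 0) a' b' s'
       \<and> edge_point (G t) a b s = edge_point (G t) a' b' s'"
      using that by blast
  qed (use edge_point_well_defined[OF graph pl _ that(1) _ that(2)] in metis)
  have "continuous_on ({0..1} \<times> edge_segment (G 0) e) h" if e: "e \<in> cells V E" for e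
  proof -
    obtain a b where ab: "e = {a, b}" "a \<in> V" "b \<in> V"
      using cell_pair[OF graph e] .
    \<comment> \<open>The parameter of a point on the edge is recovered as its relative distance
      from the first end, which depends continuously on the point.\<close>
    define s where "s = (\<lambda>z :: real \<times> complex. norm (snd z - G 0 a) / norm (G 0 b - G 0 a))"
    have s: "s (t, edge_point (G 0) a b r) = r" if "a \<noteq> b" "r \<in> {0..1}" for t :: real and r
    proof -
      have "edge_point (G 0) a b r - G 0 a = r *\<^sub>R (G 0 b - G 0 a)"
        by (simp add: edge_point_def algebra_simps)
      moreover have "G 0 b \<noteq> G 0 a"
        using planar_injD[OF pl] ab that by blast
      ultimately show ?thesis
        using that by (simp add: s_def)
    qed
    show ?thesis
    proof (cases "a = b")
      case True
      have "continuous_on ({0..1} \<times> {G 0 a}) (\<lambda>z. G (fst z) a)"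
        by (rule cont_fst[OF ab(2)])
      moreover have "h (t, G 0 a) = G t a" for t
        using h[of a a 0 t] e ab True by simp
      ultimately show ?thesis
        using ab True by (auto elim!: continuous_on_eq)
    next
      case False
      have "G 0 a \<noteq> G 0 b"
        using planar_injD[OF pl] ab False by blast
      then have "continuous_on ({0..1} \<times> edge_segment (G 0) e) (\<lambda>z. edge_point (G (fst z)) a b (s z))"
        unfolding s_def by (intro continuous_on_edge_point cont_fst ab continuous_intros) auto
      then show ?thesis
        by (rule continuous_on_eq) (use e h s False in \<open>auto simp: ab edge_segment_pair\<close>)
    qed
  qed
  then have "continuous_on (\<Union>e\<in>cells V E. {0..1} \<times> edge_segment (G 0) e) h"
    by (intro continuous_on_closed_Union finite_cells[OF graph] closed_Times compact_imp_closed
        compact_cell[OF graph]) auto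
  moreover have "(\<Union>e\<in>cells V E. {0..1} \<times> edge_segment (G 0) e) = {0..1::real} \<times> drawing_points V E (G 0)"
    by (auto simp: drawing_points_cells)
  ultimately show ?thesis
    using h that by simp
qed

end

section \<open>Points pushed off an edge, uniformly in time\<close>

context vertex_motion begin

text \<open>The distance is a continuous function of time and edge parameter, so it attains a
  minimum on the compact unit square, and \<open>avoid\<close> makes that minimum positive.\<close>

lemma segment_gap:
  assumes V: "a \<in> V" "b \<in> V" and q: "continuous_on {0..1} q"
    and avoid: "\<And>t. t \<in> {0..1} \<Longrightarrow> q t \<notin> edge_segment (G t) {a, b}"
  obtains \<epsilon> where "\<epsilon> > 0" "\<And>t x. t \<in> {0..1} \<Longrightarrow> x \<in> edge_segment (G t) {a, b} \<Longrightarrow> \<epsilon> \<le> norm (x - q t)"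
proof -
  define f where "f = (\<lambda>z. norm (edge_point (G (fst z)) a b (snd z) - q (fst z)))"
  have "continuous_on ({0..1} \<times> {0..1}) (\<lambda>z. q (fst z))"
    by (rule continuous_on_compose2[OF q]) (auto intro!: continuous_intros)
  then have "continuous_on ({0..1} \<times> {0..1}) f"
    unfolding f_def by (intro continuous_intros continuous_on_edge_point cont_fst V)
  then obtain z where z: "z \<in> {0..1} \<times> {0..1}" and min: "\<And>y. y \<in> {0..1} \<times> {0..1} \<Longrightarrow> f z \<le> f y"
    using continuous_attains_inf[of "{0..1} \<times> {0..1}" f] by (auto simp: compact_Times)
  show thesis
  proof
    have "edge_point (G (fst z)) a b (snd z) \<noteq> q (fst z)"
      using avoid[of "fst z"] z by (force simp: edge_segment_pair)
    then show "f z > 0"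
      by (simp add: f_def)
    show "f z \<le> norm (x - q t)" if "t \<in> {0..1}" "x \<in> edge_segment (G t) {a, b}" for t x
      using that min by (auto simp: edge_segment_pair f_def)
  qed
qed

text \<open>Only \<open>e0\<close> may contain \<open>q t\<close>, and it is avoided for every
  positive \<open>d\<close>. Each other cell keeps a distance from \<open>q t\<close> bounded below
  uniformly in time, so a small \<open>d\<close> serves all times and all of the finitely many
  cells.\<close>

lemma push_off_avoid:
  assumes q: "continuous_on {0..1} q" and \<delta>: "continuous_on {0..1} \<delta>"
    and other: "\<And>t e. t \<in> {0..1} \<Longrightarrow> e \<in> cells V E \<Longrightarrow> e \<noteq> e0 \<Longrightarrow> q t \<notin> edge_segment (G t) e"
    and own: "\<And>t d. t \<in> {0..1} \<Longrightarrow> 0 < d \<Longrightarrow> q t + of_real d * \<delta> t \<notin> edge_segment (G t) e0"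
  shows "\<forall>\<^sub>F d in at_right (0::real). \<forall>t\<in>{0..1}. q t + of_real d * \<delta> t \<notin> drawing_points V E (G t)"
proof -
  have "bounded (\<delta> ` {0..1})"
    by (intro compact_imp_bounded compact_continuous_image \<delta>) auto
  then obtain M where M: "M > 0" "\<And>t. t \<in> {0..1} \<Longrightarrow> norm (\<delta> t) \<le> M"
    unfolding bounded_pos by blast
  have "\<forall>\<^sub>F d in at_right (0::real). \<forall>t\<in>{0..1}. q t + of_real d * \<delta> t \<notin> edge_segment (G t) e"
    if e: "e \<in> cells V E" for e
  proof (cases "e = e0")
    case True
    then show ?thesis
      using own by (auto simp: eventually_at_right_field intro!: exI[of _ 1])
  next
    case False
    obtain a b where ab: "e = {a, b}" "a \<in> V" "b \<in> V"
      using cell_pair[OF graph e] .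
    obtain \<epsilon> where \<epsilon>: "\<epsilon> > 0" "\<And>t x. t \<in> {0..1} \<Longrightarrow> x \<in> edge_segment (G t) e \<Longrightarrow> \<epsilon> \<le> norm (x - q t)"
      using segment_gap[OF ab(2,3) q] other[OF _ e False] ab(1) by metis
    have "q t + of_real d * \<delta> t \<notin> edge_segment (G t) e" if "0 < d" "d < \<epsilon> / M" "t \<in> {0..1}" for d t
    proof
      assume "q t + of_real d * \<delta> t \<in> edge_segment (G t) e"
      then have "\<epsilon> \<le> d * norm (\<delta> t)"
        using \<epsilon>(2)[OF that(3)] that(1) by (fastforce simp: norm_mult)
      also have "\<dots> \<le> d * M"
        using M(2)[OF that(3)] that(1) by simp
      finally show False
        using that(2) M(1) by (simp add: field_simps)
    qed
    moreover have "\<epsilon> / M > 0"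
      using \<epsilon>(1) M(1) by simp
    ultimately show ?thesis
      by (auto simp: eventually_at_right_field)
  qed
  then have "\<forall>\<^sub>F d in at_right (0::real). \<forall>e\<in>cells V E. \<forall>t\<in>{0..1}. q t + of_real d * \<delta> t \<notin> edge_segment (G t) e"
    by (simp add: eventually_ball_finite finite_cells[OF graph])
  then show ?thesis
    by eventually_elim (auto simp: drawing_points_cells)
qed

end

locale planar_motion = vertex_motion +
  assumes planar: "t \<in> {0..1} \<Longrightarrow> planar_straight_line_drawing V E (G t)"
begin

lemma reverse: "planar_motion V E (\<lambda>t. G (1 - t))"
proof
  show "continuous_on {0..1} (\<lambda>t. G (1 - t) v)" if "v \<in> V" for v
    by (rule continuous_on_compose2[OF cont[OF that]]) (auto intro!: continuous_intros)
qed (auto intro: graph planar)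

text \<open>The map from \<open>transport\<close> keeps each point of the initial drawing on the
  drawing at time \<open>t\<close>, so a point that avoids the moving drawing satisfies the
  hypotheses of \<open>outside_moving_point\<close>.\<close>

lemma moving_point_outer:
  assumes p: "continuous_on {0..1} p"
    and avoid: "\<And>t. t \<in> {0..1} \<Longrightarrow> p t \<notin> drawing_points V E (G t)"
    and out: "p 1 \<in> outer_region V E (G 1)"
  shows "p 0 \<in> outer_region V E (G 0)"
proof -
  let ?D = "\<lambda>t. drawing_points V E (G t)"
  obtain h where h: "continuous_on ({0..1} \<times> ?D 0) h"
    and heq: "\<And>t a b s. {a, b} \<in> cells V E \<Longrightarrow> s \<in> {0..1} \<Longrightarrow>
           h (t, edge_point (G 0) a b s) = edge_point (G t) a b s"
    using transport[OF planar] by auto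
  have rep: "\<exists>a b s. {a, b} \<in> cells V E \<and> s \<in> {0..1} \<and> x = edge_point (G 0) a b s" if x: "x \<in> ?D 0" for x
  proof -
    obtain e where e: "e \<in> cells V E" "x \<in> edge_segment (G 0) e"
      using x by (auto simp: drawing_points_cells)
    then show ?thesis
      using cell_pair[OF graph e(1)] by (metis edge_segment_pair imageE)
  qed
  have hD: "h (t, x) \<in> ?D t" if "x \<in> ?D 0" for t x
    using rep[OF that] heq unfolding drawing_points_cells by (force simp: edge_segment_pair)
  show ?thesis
    unfolding outer_region_def
  proof (rule outside_moving_point)
    show "compact (?D 0)" "compact (?D 1)"
      by (simp_all add: compact_drawing_points[OF graph])
    show "h (0, x) = x" if "x \<in> ?D 0" for x
      using rep[OF that] heq by metis
    show "h (t, x) \<noteq> p t" if "t \<in> {0..1}" "x \<in> ?D 0" for t x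
      using hD avoid that by metis
  qed (use h hD p out in \<open>auto simp: outer_region_def\<close>)
qed

text \<open>The other direction is \<open>moving_point_outer\<close> for the reversed
  motion.\<close>

lemma moving_point_outer_iff:
  assumes p: "continuous_on {0..1} p"
    and avoid: "\<And>t. t \<in> {0..1} \<Longrightarrow> p t \<notin> drawing_points V E (G t)"
  shows "p 0 \<in> outer_region V E (G 0) \<longleftrightarrow> p 1 \<in> outer_region V E (G 1)"
proof
  interpret rev: planar_motion V E "\<lambda>t. G (1 - t)"
    by (rule reverse)
  have "continuous_on {0..1} (\<lambda>t. p (1 - t))"
    by (rule continuous_on_compose2[OF p]) (auto intro!: continuous_intros)
  then show "p 1 \<in> outer_region V E (G 1)" if "p 0 \<in> outer_region V E (G 0)"
    using rev.moving_point_outer[of "\<lambda>t. p (1 - t)"] avoid that by simp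
qed (use moving_point_outer[OF p] avoid in auto)

lemma push_off_outer:
  assumes "continuous_on {0..1} q" "continuous_on {0..1} \<delta>"
    and "\<And>t e. t \<in> {0..1} \<Longrightarrow> e \<in> cells V E \<Longrightarrow> e \<noteq> e0 \<Longrightarrow> q t \<notin> edge_segment (G t) e"
    and "\<And>t d. t \<in> {0..1} \<Longrightarrow> 0 < d \<Longrightarrow> q t + of_real d * \<delta> t \<notin> edge_segment (G t) e0"
  shows "(\<forall>\<^sub>F d in at_right (0::real). q 0 + of_real d * \<delta> 0 \<in> outer_region V E (G 0)) \<longleftrightarrow>
    (\<forall>\<^sub>F d in at_right 0. q 1 + of_real d * \<delta> 1 \<in> outer_region V E (G 1))"
proof -
  have "\<forall>\<^sub>F d in at_right (0::real). q 0 + of_real d * \<delta> 0 \<in> outer_region V E (G 0) \<longleftrightarrow>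
      q 1 + of_real d * \<delta> 1 \<in> outer_region V E (G 1)"
  proof (rule eventually_mono)
    show "\<forall>\<^sub>F d in at_right (0::real). \<forall>t\<in>{0..1}. q t + of_real d * \<delta> t \<notin> drawing_points V E (G t)"
      by (rule push_off_avoid[where ?e0.0 = e0, OF assms(1,2)]) (use assms(3,4) in auto)
    show "q 0 + of_real d * \<delta> 0 \<in> outer_region V E (G 0) \<longleftrightarrow> q 1 + of_real d * \<delta> 1 \<in> outer_region V E (G 1)"
      if "\<forall>t\<in>{0..1}. q t + of_real d * \<delta> t \<notin> drawing_points V E (G t)" for d
      using that by (intro moving_point_outer_iff[of "\<lambda>t. q t + of_real d * \<delta> t"] continuous_intros assms(1,2)) auto
  qed
  then show ?thesis
    by (rule eventually_cong)
qed

end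

section \<open>The outer face under motion\<close>

text \<open>This is the condition in \<open>outer_sides\<close> at a single point of the edge,
  indexed by its parameter so that it can be compared between drawings.\<close>

definition outer_on_left :: "'v set \<Rightarrow> 'v set set \<Rightarrow> 'v drawing \<Rightarrow> 'v \<Rightarrow> 'v \<Rightarrow> real \<Rightarrow> bool" where
  "outer_on_left V E \<Gamma> u v s \<longleftrightarrow>
     (\<forall>\<^sub>F d in at_right (0::real). edge_point \<Gamma> u v s + of_real d * (\<i> * (\<Gamma> v - \<Gamma> u)) \<in> outer_region V E \<Gamma>)"

text \<open>Factoring \<open>\<Gamma> v - \<Gamma> u\<close> out of the difference from a point of
  the edge leaves a complex number with imaginary part \<open>d\<close>.\<close>

lemma off_edge:
  assumes "\<Gamma> u \<noteq> \<Gamma> v" "d \<noteq> 0"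
  shows "edge_point \<Gamma> u v s + of_real d * (\<i> * (\<Gamma> v - \<Gamma> u)) \<notin> edge_segment \<Gamma> {u, v}"
proof
  assume "edge_point \<Gamma> u v s + of_real d * (\<i> * (\<Gamma> v - \<Gamma> u)) \<in> edge_segment \<Gamma> {u, v}"
  then obtain r where "edge_point \<Gamma> u v s + of_real d * (\<i> * (\<Gamma> v - \<Gamma> u)) = edge_point \<Gamma> u v r"
    by (auto simp: edge_segment_pair)
  then have "(\<Gamma> v - \<Gamma> u) * (of_real (s - r) + \<i> * of_real d) = 0"
    by (simp add: edge_point_def scaleR_conv_of_real algebra_simps)
  then have "of_real (s - r) + \<i> * of_real d = 0"
    using assms(1) by simp
  then show False
    using assms(2) by (auto simp: complex_eq_iff)
qed

lemma edge_interior_only: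
  assumes sg: "simple_graph V E" and pl: "planar_straight_line_drawing V E \<Gamma>"
    and uv: "{u, v} \<in> E" and s: "0 < s" "s < 1" and e: "e \<in> cells V E" "e \<noteq> {u, v}"
  shows "edge_point \<Gamma> u v s \<notin> edge_segment \<Gamma> e"
proof
  assume "edge_point \<Gamma> u v s \<in> edge_segment \<Gamma> e"
  moreover have "edge_point \<Gamma> u v s \<in> edge_segment \<Gamma> {u, v}"
    using s by (simp add: edge_segment_pair)
  ultimately have "edge_point \<Gamma> u v s \<in> \<Gamma> ` (e \<inter> {u, v})"
    using planar_cells[OF sg pl e(1) _ e(2)] uv by (auto simp: cells_def)
  moreover have "\<Gamma> u \<noteq> \<Gamma> v"
    using planar_injD[OF pl] edge_pairD[OF sg uv] by blast
  ultimately show False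
    using edge_point_inj[of \<Gamma> u v s 0] edge_point_inj[of \<Gamma> u v s 1] s by auto
qed

lemma outer_sides_eq:
  "outer_sides V E \<Gamma> = {(u, v). {u, v} \<in> E \<and> (\<forall>s. 0 < s \<longrightarrow> s < 1 \<longrightarrow> outer_on_left V E \<Gamma> u v s)}"
  if sg: "simple_graph V E" and pl: "planar_straight_line_drawing V E \<Gamma>"
proof -
  have "open_segment (\<Gamma> u) (\<Gamma> v) = edge_point \<Gamma> u v ` {0<..<1}" if "{u, v} \<in> E" for u v
  proof -
    have "\<Gamma> u \<noteq> \<Gamma> v"
      using planar_injD[OF pl] edge_pairD[OF sg that] by blast
    then show ?thesis
      by (auto simp: in_segment edge_point_def)
  qed
  then show ?thesis
    by (auto simp: outer_sides_def outer_on_left_def)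
qed

lemma isolated_cell:
  assumes sg: "simple_graph V E" and e: "e \<in> cells V E" and "v \<in> e" and iso: "\<And>a. {v, a} \<notin> E"
  shows "e = {v}"
proof -
  have False if "e \<in> E"
    using edge_pair[OF sg that] assms(3) iso that by (metis insertE insert_commute singletonD)
  then show ?thesis
    using e \<open>v \<in> e\<close> by (auto simp: cells_def)
qed

context planar_motion begin

lemma outer_on_left_invariant:
  assumes uv: "{u, v} \<in> E" and s: "0 < s" "s < 1"
  shows "outer_on_left V E (G 0) u v s \<longleftrightarrow> outer_on_left V E (G 1) u v s"
  unfolding outer_on_left_def
proof (rule push_off_outer)
  note V = edge_pairD[OF graph uv]
  show "continuous_on {0..1} (\<lambda>t. edge_point (G t) u v s)" "continuous_on {0..1} (\<lambda>t. \<i> * (G t v - G t u))"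
    by (intro continuous_on_edge_point continuous_intros cont V)+
  show "edge_point (G t) u v s \<notin> edge_segment (G t) e"
    if "t \<in> {0..1}" "e \<in> cells V E" "e \<noteq> {u, v}" for t e
    using edge_interior_only[OF graph planar uv s] that by blast
  show "edge_point (G t) u v s + of_real d * (\<i> * (G t v - G t u)) \<notin> edge_segment (G t) {u, v}"
    if "t \<in> {0..1}" "0 < d" for t d
    using off_edge[of "G t" u v d s] planar_injD[OF planar[OF that(1)]] V that by blast
qed

lemma outer_sides_invariant: "outer_sides V E (G 0) = outer_sides V E (G 1)"
  using outer_on_left_invariant by (simp add: outer_sides_eq[OF graph planar]) blast

text \<open>An isolated vertex has no incident edge whose left side could be tested, so the test
  points are taken in a fixed direction, to the right of the vertex.\<close>

lemma isolated_invariant: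
  assumes v: "v \<in> V" and iso: "\<And>a. {v, a} \<notin> E"
  shows "(\<forall>\<^sub>F d in at_right (0::real). G 0 v + of_real d \<in> outer_region V E (G 0)) \<longleftrightarrow>
    (\<forall>\<^sub>F d in at_right 0. G 1 v + of_real d \<in> outer_region V E (G 1))"
proof -
  have "G t v \<notin> edge_segment (G t) e" if t: "t \<in> {0..1}" and e: "e \<in> cells V E" "e \<noteq> {v}" for t e
  proof -
    have "v \<notin> e"
      using isolated_cell[OF graph e(1)] iso e(2) by blast
    then show ?thesis
      using planar_cells[OF graph planar[OF t] e(1) _ e(2)] v by (auto simp: cells_def)
  qed
  then show ?thesis
    using push_off_outer[of "\<lambda>t. G t v" "\<lambda>_. 1" "{v}"] cont[OF v] by simp
qed

end

section \<open>Vertices on the boundary of the outer face\<close>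

lemma connected_subset_outer_region:
  assumes "connected S" "S \<inter> drawing_points V E \<Gamma> = {}" "x \<in> S" "x \<in> outer_region V E \<Gamma>"
  shows "S \<subseteq> outer_region V E \<Gamma>"
proof
  fix y assume "y \<in> S"
  then have "connected_component (- drawing_points V E \<Gamma>) x y"
    using assms(1-3) unfolding connected_component_def by blast
  then show "y \<in> outer_region V E \<Gamma>"
    using assms(4) outside_same_component unfolding outer_region_def by blast
qed

text \<open>A vertex lies on the drawing, hence never in the outer region, so for it frontier and
  closure amount to the same.\<close>

lemma outer_vertices_iff_closure:
  assumes "v \<in> V"
  shows "v \<in> outer_vertices V E \<Gamma> \<longleftrightarrow> \<Gamma> v \<in> closure (outer_region V E \<Gamma>)"
proof -
  have "\<Gamma> v \<in> drawing_points V E \<Gamma>"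
    using assms by (simp add: drawing_points_def)
  then have "\<Gamma> v \<notin> outer_region V E \<Gamma>"
    using outside_no_overlap unfolding outer_region_def by blast
  then show ?thesis
    using assms interior_subset by (auto simp: outer_vertices_def frontier_def)
qed

lemma vertex_neighbourhood:
  assumes sg: "simple_graph V E" and pl: "planar_straight_line_drawing V E \<Gamma>" and v: "v \<in> V"
  obtains r where "r > 0" "\<And>e. e \<in> cells V E \<Longrightarrow> v \<notin> e \<Longrightarrow> ball (\<Gamma> v) r \<inter> edge_segment \<Gamma> e = {}"
proof -
  define F where "F = (\<Union>e\<in>{e \<in> cells V E. v \<notin> e}. edge_segment \<Gamma> e)"
  have "closed F"
    unfolding F_def
    using compact_cell[OF sg] finite_cells[OF sg] by (intro closed_UN) (auto intro: compact_imp_closed)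
  moreover have "\<Gamma> v \<notin> edge_segment \<Gamma> e" if "e \<in> cells V E" "v \<notin> e" for e
    using planar_cells[OF sg pl that(1), of "{v}"] that v by (auto simp: cells_def)
  then have "\<Gamma> v \<notin> F"
    unfolding F_def by blast
  ultimately obtain r where "r > 0" "ball (\<Gamma> v) r \<subseteq> - F"
    using openE[of "- F" "\<Gamma> v"] by auto
  then show thesis
    using that[of r] unfolding F_def by blast
qed

text \<open>A small punctured disc around an isolated vertex is connected and misses the drawing, so
  it lies in the outer region as soon as one of its points does.\<close>

lemma outer_vertex_isolated:
  assumes sg: "simple_graph V E" and pl: "planar_straight_line_drawing V E \<Gamma>" and v: "v \<in> V"
    and iso: "\<And>a. {v, a} \<notin> E"
  shows "v \<in> outer_vertices V E \<Gamma> \<longleftrightarrow> (\<forall>\<^sub>F d in at_right (0::real). \<Gamma> v + of_real d \<in> outer_region V E \<Gamma>)"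
    (is "?L \<longleftrightarrow> ?R")
proof
  assume ?L
  obtain r where r: "r > 0" "\<And>e. e \<in> cells V E \<Longrightarrow> v \<notin> e \<Longrightarrow> ball (\<Gamma> v) r \<inter> edge_segment \<Gamma> e = {}"
    using vertex_neighbourhood[OF sg pl v] by metis
  let ?S = "ball (\<Gamma> v) r - {\<Gamma> v}"
  have "e = {v}" if "e \<in> cells V E" "v \<in> e" for e
    using isolated_cell[OF sg that] iso by blast
  then have D: "?S \<inter> drawing_points V E \<Gamma> = {}"
    using r(2) unfolding drawing_points_cells by fastforce
  obtain p where p: "p \<in> outer_region V E \<Gamma>" "dist p (\<Gamma> v) < r"
    using \<open>?L\<close> r(1) by (auto simp: outer_vertices_iff_closure[OF v] closure_approachable)
  moreover have "p \<noteq> \<Gamma> v"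
    using p(1) v outside_no_overlap unfolding outer_region_def drawing_points_def by blast
  ultimately have "?S \<subseteq> outer_region V E \<Gamma>"
    by (intro connected_subset_outer_region[OF _ D, of p] connected_punctured_ball) (auto simp: dist_commute)
  moreover have "\<Gamma> v + of_real d \<in> ?S" if "0 < d" "d < r" for d
    using that by (auto simp: dist_norm)
  ultimately have "\<Gamma> v + of_real d \<in> outer_region V E \<Gamma>" if "0 < d" "d < r" for d
    using that by blast
  then show ?R
    using r(1) by (auto simp: eventually_at_right_field)
next
  assume ?R
  then obtain b where b: "b > 0" "\<And>d. 0 < d \<Longrightarrow> d < b \<Longrightarrow> \<Gamma> v + of_real d \<in> outer_region V E \<Gamma>"
    by (auto simp: eventually_at_right_field)
  have "\<exists>y\<in>outer_region V E \<Gamma>. dist y (\<Gamma> v) < \<epsilon>" if "\<epsilon> > 0" for \<epsilon>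
    using b(2)[of "min b \<epsilon> / 2"] b(1) that
    by (intro bexI[of _ "\<Gamma> v + of_real (min b \<epsilon> / 2)"]) (auto simp: dist_norm simp del: of_real_divide)
  then show ?L
    by (simp add: outer_vertices_iff_closure[OF v] closure_approachable)
qed

text \<open>Polar coordinates present the sector as a continuous image of a rectangle.\<close>

lemma rcis_sector_connected: "connected ((\<lambda>z. p + rcis (fst z) (snd z) * w) ` ({0<..<\<kappa>} \<times> {0<..\<theta>}))"
  unfolding rcis_def
  by (intro connected_continuous_image connected_Times continuous_intros convex_connected convex_real_interval)

text \<open>A point pushed off the edge at parameter \<open>s\<close> has distance at most
  \<open>(s + d) * norm (\<Gamma> a - \<Gamma> v)\<close> from the vertex, and \<open>d\<close> can
  be taken arbitrarily small.\<close>

lemma outer_on_left_close: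
  assumes "outer_on_left V E \<Gamma> v a s" "0 < s" "s * norm (\<Gamma> a - \<Gamma> v) < \<epsilon>"
  shows "\<exists>y\<in>outer_region V E \<Gamma>. dist y (\<Gamma> v) < \<epsilon>"
proof -
  let ?w = "\<Gamma> a - \<Gamma> v"
  have "((\<lambda>d. s * norm ?w + d * norm ?w) \<longlongrightarrow> s * norm ?w + 0 * norm ?w) (at_right 0)"
    by (intro tendsto_intros)
  then have "\<forall>\<^sub>F d in at_right 0. s * norm ?w + d * norm ?w < \<epsilon>"
    using assms(3) by (intro order_tendstoD(2)) auto
  moreover have "\<forall>\<^sub>F d in at_right 0. (0::real) < d"
    by (simp add: eventually_at_right_less)
  ultimately have "\<forall>\<^sub>F d in at_right 0. s * norm ?w + d * norm ?w < \<epsilon> \<and> 0 < d \<and>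
      edge_point \<Gamma> v a s + of_real d * (\<i> * ?w) \<in> outer_region V E \<Gamma>"
    using assms(1) unfolding outer_on_left_def by (intro eventually_conj)
  then obtain d where d: "s * norm ?w + d * norm ?w < \<epsilon>" "0 < d"
      "edge_point \<Gamma> v a s + of_real d * (\<i> * ?w) \<in> outer_region V E \<Gamma>"
    using eventually_happens'[OF trivial_limit_at_right_real] by blast
  have "dist (edge_point \<Gamma> v a s + of_real d * (\<i> * ?w)) (\<Gamma> v) = norm (s *\<^sub>R ?w + of_real d * (\<i> * ?w))"
    by (simp add: dist_norm edge_point_def algebra_simps)
  also have "\<dots> \<le> s * norm ?w + d * norm ?w"
    using assms(2) d(2) by (intro norm_triangle_le) (simp add: norm_mult)
  finally show ?thesis
    using d by force
qed

text \<open>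
  Turning clockwise around \<open>v\<close> from a nearby point of the outer face until the first edge is hit
  gives an edge with the outer face on its left.
\<close>

lemma outer_on_left_exists:
  assumes sg: "simple_graph V E" and pl: "planar_straight_line_drawing V E \<Gamma>"
    and vc: "{v, c} \<in> E" and out: "\<Gamma> v \<in> closure (outer_region V E \<Gamma>)" and "\<epsilon> > 0"
  shows "\<exists>a s. {v, a} \<in> E \<and> 0 < s \<and> s < 1 \<and> s < \<epsilon> \<and> outer_on_left V E \<Gamma> v a s"
proof -
  let ?O = "outer_region V E \<Gamma>"
  have v: "v \<in> V"
    using edge_pairD[OF sg vc] by simp
  have ne: "\<Gamma> a \<noteq> \<Gamma> v" if "{v, a} \<in> E" for a
    using planar_injD[OF pl] edge_pairD[OF sg that] by blast
  obtain r0 where r0: "r0 > 0"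
    "\<And>e. e \<in> cells V E \<Longrightarrow> v \<notin> e \<Longrightarrow> ball (\<Gamma> v) r0 \<inter> edge_segment \<Gamma> e = {}"
    using vertex_neighbourhood[OF sg pl v] by metis
  define N where "N = {a. {v, a} \<in> E}"
  have "N \<subseteq> V"
    using edge_pairD[OF sg] by (auto simp: N_def)
  then have N: "finite N" "N \<noteq> {}"
    using sg vc finite_subset by (auto simp: N_def simple_graph_def)
  define m where "m = Min ((\<lambda>a. norm (\<Gamma> a - \<Gamma> v)) ` N)"
  have m: "m > 0" "\<And>a. a \<in> N \<Longrightarrow> m \<le> norm (\<Gamma> a - \<Gamma> v)"
    using N ne by (auto simp: m_def N_def)
  \<comment> \<open>The bound \<open>r0\<close> excludes all cells that do not contain
    \<open>v\<close>. The factor \<open>m\<close>, at most the length of any edge at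
    \<open>v\<close>, makes the parameter \<open>s\<close> below smaller than both
    \<open>\<epsilon>\<close> and 1.\<close>
  define \<rho> where "\<rho> = min r0 (min \<epsilon> 1 * m)"
  have "\<rho> > 0"
    using r0(1) \<open>\<epsilon> > 0\<close> m(1) by (simp add: \<rho>_def)
  then obtain p where p: "p \<in> ?O" "dist p (\<Gamma> v) < \<rho>"
    using out by (auto simp: closure_approachable)
  have pD: "p \<notin> drawing_points V E \<Gamma>"
    using p(1) outside_no_overlap unfolding outer_region_def by blast
  then have pv: "p \<noteq> \<Gamma> v"
    using v by (auto simp: drawing_points_def)
  \<comment> \<open>\<open>A a\<close> is the counterclockwise angle from the edge \<open>va\<close>
    to \<open>p\<close>; its minimum selects the first edge met when turning clockwise from
    \<open>p\<close>.\<close>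
  define A where "A = (\<lambda>a. Arg2pi ((p - \<Gamma> v) / (\<Gamma> a - \<Gamma> v)))"
  obtain a where a: "a \<in> N" and amin: "\<And>b. b \<in> N \<Longrightarrow> A a \<le> A b"
    using ex_min_if_finite[of "A ` N"] N by fastforce
  define w where "w = \<Gamma> a - \<Gamma> v"
  define \<kappa> where "\<kappa> = \<rho> / norm w"
  define s where "s = norm (p - \<Gamma> v) / norm w"
  have va: "{v, a} \<in> E"
    using a by (simp add: N_def)
  have w: "norm w > 0" "m \<le> norm w"
    using ne[OF va] m(2)[OF a] by (auto simp: w_def)
  have s: "0 < s" "s < \<kappa>"
    using pv w p(2) by (auto simp: s_def \<kappa>_def dist_norm divide_strict_right_mono)
  have "\<rho> \<le> min \<epsilon> 1 * norm w"
    using w(2) \<open>\<epsilon> > 0\<close> by (simp add: \<rho>_def min.coboundedI2 mult_left_mono)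
  then have "\<kappa> \<le> min \<epsilon> 1"
    using w(1) by (simp only: \<kappa>_def pos_divide_le_eq)
  then have s': "s < \<epsilon>" "s < 1"
    using s by auto
  have "(p - \<Gamma> v) / w = rcis s (A a)"
    using Arg2pi_eq[of "(p - \<Gamma> v) / w"] by (simp add: A_def w_def s_def rcis_def cis_conv_exp norm_divide)
  then have p_eq: "p = \<Gamma> v + rcis s (A a) * w"
    using w by (simp add: field_simps)
  have "A a \<noteq> 0"
  proof
    assume "A a = 0"
    then have "p = edge_point \<Gamma> v a s"
      using p_eq by (simp add: edge_point_def w_def rcis_def scaleR_conv_of_real algebra_simps)
    then have "p \<in> edge_segment \<Gamma> {v, a}"
      using s s' by (simp add: edge_segment_pair)
    then show False
      using pD va by (auto simp: drawing_points_def)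
  qed
  then have A: "0 < A a" "A a < 2 * pi"
    using Arg2pi_ge_0 Arg2pi_lt_2pi by (auto simp: A_def order_less_le)
  \<comment> \<open>The sector is swept from the ray through \<open>p\<close>, included, clockwise
    to the edge \<open>va\<close>, excluded, with radii in units of \<open>norm w\<close>. A drawing
    point at angle \<open>\<phi>\<close> in it would lie on an edge \<open>vb\<close> with
    \<open>A b = A a - \<phi>\<close>, against minimality.\<close>
  define S where "S = (\<lambda>z. \<Gamma> v + rcis (fst z) (snd z) * w) ` ({0<..<\<kappa>} \<times> {0<..A a})"
  have "x \<notin> drawing_points V E \<Gamma>" if xS: "x \<in> S" for x
  proof
    assume "x \<in> drawing_points V E \<Gamma>"
    then obtain e where e: "e \<in> cells V E" "x \<in> edge_segment \<Gamma> e"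
      by (auto simp: drawing_points_cells)
    obtain r \<phi> where r: "0 < r" "r < \<kappa>" "0 < \<phi>" "\<phi> \<le> A a" and x: "x = \<Gamma> v + rcis r \<phi> * w"
      using xS by (auto simp: S_def)
    have "norm (x - \<Gamma> v) = r * norm w"
      using r by (simp add: x norm_mult)
    moreover have "r * norm w < r0"
      using r w by (simp add: \<kappa>_def \<rho>_def field_simps)
    ultimately have "x \<in> ball (\<Gamma> v) r0"
      by (simp add: dist_norm norm_minus_commute)
    then have "v \<in> e"
      using r0(2)[OF e(1)] e(2) by blast
    have xv: "x \<noteq> \<Gamma> v"
      using r w by (auto simp: x)
    have "e \<in> E"
      using e xv \<open>v \<in> e\<close> by (auto simp: cells_def)
    then obtain b where b: "e = {v, b}" "{v, b} \<in> E"
      using edge_pair[OF sg] \<open>v \<in> e\<close> by (metis insertE insert_commute singletonD)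
    then obtain \<sigma> where \<sigma>: "0 \<le> \<sigma>" "\<sigma> \<le> 1" "x = edge_point \<Gamma> v b \<sigma>"
      using e(2) by (auto simp: edge_segment_pair)
    then have "\<sigma> > 0"
      using xv by (auto simp: order_less_le)
    have "rcis r \<phi> * w = of_real \<sigma> * (\<Gamma> b - \<Gamma> v)"
      using x \<sigma>(3) by (simp add: edge_point_def scaleR_conv_of_real algebra_simps)
    moreover have "rcis s (A a) = rcis (s / r) (A a - \<phi>) * rcis r \<phi>"
      using r by (simp add: rcis_mult)
    ultimately have "p - \<Gamma> v = rcis (s / r) (A a - \<phi>) * (of_real \<sigma> * (\<Gamma> b - \<Gamma> v))"
      using p_eq by (simp add: mult.assoc)
    then have "(p - \<Gamma> v) / (\<Gamma> b - \<Gamma> v) = rcis (s / r) (A a - \<phi>) * of_real \<sigma>"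
      using ne[OF b(2)] by simp
    then have "(p - \<Gamma> v) / (\<Gamma> b - \<Gamma> v) = of_real (s / r * \<sigma>) * exp (\<i> * of_real (A a - \<phi>))"
      by (simp add: rcis_def cis_conv_exp)
    then have "Arg2pi ((p - \<Gamma> v) / (\<Gamma> b - \<Gamma> v)) = A a - \<phi>"
      using s r A \<open>\<sigma> > 0\<close> by (intro Arg2pi_unique[of "s / r * \<sigma>"]) auto
    then have "A b = A a - \<phi>"
      by (simp add: A_def)
    then show False
      using amin[of b] b r by (simp add: N_def)
  qed
  then have "S \<inter> drawing_points V E \<Gamma> = {}"
    by blast
  moreover have "connected S"
    unfolding S_def by (rule rcis_sector_connected)
  moreover have "p \<in> S"
    using s A p_eq by (force simp: S_def)
  ultimately have S: "S \<subseteq> ?O"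
    using p(1) connected_subset_outer_region by metis
  \<comment> \<open>In coordinates with origin \<open>\<Gamma> v\<close> and unit \<open>w\<close>,
    the pushed point is \<open>Complex s d\<close>. As \<open>d\<close> tends to 0 its argument
    tends to 0 and its modulus to \<open>s < \<kappa>\<close>, so it enters the sector.\<close>
  have upper: "continuous_on {0..} (\<lambda>d. Arg2pi (Complex s d))"
    by (rule continuous_on_compose2[OF continuous_on_upperhalf_Arg2pi])
      (use s in \<open>auto simp: Complex_eq complex_eq_iff intro!: continuous_intros\<close>)
  have "((\<lambda>d. Arg2pi (Complex s d)) \<longlongrightarrow> Arg2pi (Complex s 0)) (at_right 0)"
    using upper by (auto simp: continuous_on_def intro: tendsto_within_subset)
  then have "\<forall>\<^sub>F d in at_right 0. Arg2pi (Complex s d) < A a"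
    using A s Arg2pi_of_real[of s] by (intro order_tendstoD(2)) (auto simp: complex_of_real_def)
  moreover have "((\<lambda>d. norm (Complex s d)) \<longlongrightarrow> norm (Complex s 0)) (at_right 0)"
    unfolding Complex_eq by (intro tendsto_intros)
  then have "\<forall>\<^sub>F d in at_right 0. norm (Complex s d) < \<kappa>"
    using s by (intro order_tendstoD(2)) (auto simp: complex_norm)
  moreover have "\<forall>\<^sub>F d in at_right 0. (0::real) < d"
    by (simp add: eventually_at_right_less)
  ultimately have "\<forall>\<^sub>F d in at_right 0. edge_point \<Gamma> v a s + of_real d * (\<i> * (\<Gamma> a - \<Gamma> v)) \<in> ?O"
  proof eventually_elim
    case (elim d)
    have "edge_point \<Gamma> v a s + of_real d * (\<i> * (\<Gamma> a - \<Gamma> v)) = \<Gamma> v + Complex s d * w"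
      by (simp add: edge_point_def w_def Complex_eq scaleR_conv_of_real algebra_simps)
    also have "Complex s d = rcis (norm (Complex s d)) (Arg2pi (Complex s d))"
      using Arg2pi_eq[of "Complex s d"] by (simp add: rcis_def cis_conv_exp)
    also have "\<Gamma> v + \<dots> * w \<in> S"
      using elim Arg2pi_lt_pi[of "Complex s d"] s
      unfolding S_def by (intro image_eqI[of _ _ "(norm (Complex s d), Arg2pi (Complex s d))"]) (auto simp: complex_eq_iff)
    finally show ?case
      using S by blast
  qed
  then show ?thesis
    using va s s' unfolding outer_on_left_def by blast
qed

text \<open>This reduces incidence with the outer face to \<open>outer_on_left\<close>, which a
  planar motion preserves. Edge lengths are bounded, so parameters tending to 0 give points tending
  to the vertex.\<close>

lemma outer_vertex_nonisolated:
  assumes sg: "simple_graph V E" and pl: "planar_straight_line_drawing V E \<Gamma>" and vc: "{v, c} \<in> E"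
  shows "v \<in> outer_vertices V E \<Gamma> \<longleftrightarrow>
    (\<forall>\<epsilon>>0. \<exists>a s. {v, a} \<in> E \<and> 0 < s \<and> s < 1 \<and> s < \<epsilon> \<and> outer_on_left V E \<Gamma> v a s)" (is "_ \<longleftrightarrow> ?R")
proof -
  have v: "v \<in> V"
    using edge_pairD[OF sg vc] by simp
  have "\<exists>y\<in>outer_region V E \<Gamma>. dist y (\<Gamma> v) < \<eta>" if ?R "\<eta> > 0" for \<eta>
  proof -
    have "finite V"
      using sg by (simp add: simple_graph_def)
    then obtain M where M: "M > 0" "\<And>a. a \<in> V \<Longrightarrow> norm (\<Gamma> a - \<Gamma> v) \<le> M"
      using finite_imp_bounded[of "(\<lambda>a. \<Gamma> a - \<Gamma> v) ` V"] by (auto simp: bounded_pos)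
    then obtain a s where as: "{v, a} \<in> E" "0 < s" "s < \<eta> / M" "outer_on_left V E \<Gamma> v a s"
      using \<open>?R\<close>[rule_format, of "\<eta> / M"] \<open>\<eta> > 0\<close> by auto
    have "s * norm (\<Gamma> a - \<Gamma> v) \<le> s * M"
      using as M edge_pairD[OF sg as(1)] by (intro mult_left_mono) auto
    also have "\<dots> < \<eta>"
      using as M by (simp add: field_simps)
    finally show ?thesis
      using outer_on_left_close as by metis
  qed
  then show ?thesis
    using outer_on_left_exists[OF sg pl vc] by (auto simp: outer_vertices_iff_closure[OF v] closure_approachable)
qed

lemma (in planar_motion) outer_vertices_invariant: "outer_vertices V E (G 0) = outer_vertices V E (G 1)"
proof -
  have "v \<in> outer_vertices V E (G 0) \<longleftrightarrow> v \<in> outer_vertices V E (G 1)" if v: "v \<in> V" for v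
  proof (cases "\<exists>c. {v, c} \<in> E")
    case True
    then obtain c where vc: "{v, c} \<in> E" ..
    have pl: "planar_straight_line_drawing V E (G 0)" "planar_straight_line_drawing V E (G 1)"
      by (simp_all add: planar)
    show ?thesis
      unfolding outer_vertex_nonisolated[OF graph pl(1) vc] outer_vertex_nonisolated[OF graph pl(2) vc]
      using outer_on_left_invariant by blast
  next
    case False
    then show ?thesis
      using outer_vertex_isolated[OF graph planar v] isolated_invariant[OF v] by simp
  qed
  then show ?thesis
    by (auto simp: outer_vertices_def)
qed

section \<open>Circular orders under motion\<close>

lemma same_sign_endpoints:
  fixes F :: "real \<Rightarrow> real"
  assumes "continuous_on {0..1} F" "\<And>t. t \<in> {0..1} \<Longrightarrow> F t \<noteq> 0"
  shows "F 0 < 0 \<longleftrightarrow> F 1 < 0"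
  using IVT'[of F 0 0 1] IVT2'[of F 1 0 0] assms
  by (metis atLeastAtMost_iff linear not_le zero_le_one)

text \<open>Of two edges with the same direction at \<open>v\<close>, the one that is not longer
  would end on the other, placing a vertex on an edge that does not contain it. The comparison of
  \<open>k\<close> with 1 decides which.\<close>

lemma edge_directions_differ:
  assumes sg: "simple_graph V E" and pl: "planar_straight_line_drawing V E \<Gamma>"
    and va: "{v, a} \<in> E" and vb: "{v, b} \<in> E" and "a \<noteq> b"
  shows "(\<Gamma> b - \<Gamma> v) / (\<Gamma> a - \<Gamma> v) \<notin> \<real>\<^sub>\<ge>\<^sub>0"
proof
  have avoid: "\<Gamma> j \<noteq> edge_point \<Gamma> v i s" if "{v, i} \<in> E" "{v, j} \<in> E" "i \<noteq> j" "s \<in> {0..1}" for i j s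
    using planar_cells[OF sg pl, of "{j}" "{v, i}"] that edge_pairD[OF sg that(2)]
    by (auto simp: cells_def edge_segment_pair)
  have ne: "\<Gamma> a \<noteq> \<Gamma> v" "\<Gamma> b \<noteq> \<Gamma> v"
    using planar_injD[OF pl] edge_pairD[OF sg va] edge_pairD[OF sg vb] by blast+
  assume "(\<Gamma> b - \<Gamma> v) / (\<Gamma> a - \<Gamma> v) \<in> \<real>\<^sub>\<ge>\<^sub>0"
  then obtain k where k: "k \<ge> 0" "(\<Gamma> b - \<Gamma> v) / (\<Gamma> a - \<Gamma> v) = of_real k"
    by (auto simp: nonneg_Reals_def)
  then have eq: "\<Gamma> b - \<Gamma> v = of_real k * (\<Gamma> a - \<Gamma> v)"
    using ne by (simp add: field_simps)
  then have "k > 0"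
    using k(1) ne by (auto simp: order_less_le)
  show False
  proof (cases "k \<le> 1")
    case True
    have "\<Gamma> b = edge_point \<Gamma> v a k"
      using eq by (simp add: edge_point_def scaleR_conv_of_real algebra_simps)
    then show False
      using avoid[OF va vb, of k] True \<open>k > 0\<close> \<open>a \<noteq> b\<close> by simp
  next
    case False
    have "\<Gamma> a - \<Gamma> v = of_real (1 / k) * (\<Gamma> b - \<Gamma> v)"
      using eq \<open>k > 0\<close> by simp
    then have "\<Gamma> a = edge_point \<Gamma> v b (1 / k)"
      by (simp add: edge_point_def scaleR_conv_of_real algebra_simps)
    then show False
      using avoid[OF vb va, of "1 / k"] False \<open>a \<noteq> b\<close> by simp
  qed
qed

text \<open>By \<open>edge_directions_differ\<close> the direction quotients avoid the nonnegative
  reals, where \<open>Arg2pi\<close> jumps, so the angles vary continuously. Equal angles would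
  align \<open>vb\<close> with \<open>vc\<close>; hence the difference of the two angles keeps its
  sign.\<close>

lemma (in planar_motion) circular_order_invariant: "circular_order E (G 0) = circular_order E (G 1)"
proof -
  have "Arg2pi ((G 0 b - G 0 v) / (G 0 a - G 0 v)) < Arg2pi ((G 0 c - G 0 v) / (G 0 a - G 0 v)) \<longleftrightarrow>
      Arg2pi ((G 1 b - G 1 v) / (G 1 a - G 1 v)) < Arg2pi ((G 1 c - G 1 v) / (G 1 a - G 1 v))"
    if e: "{v, a} \<in> E" "{v, b} \<in> E" "{v, c} \<in> E" "a \<noteq> b" "a \<noteq> c" "b \<noteq> c" for v a b c
  proof -
    define R where "R = (\<lambda>i t. (G t i - G t v) / (G t a - G t v))"
    have ne: "G t i \<noteq> G t v" if "{v, i} \<in> E" "t \<in> {0..1}" for t i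
      using planar_injD[OF planar[OF that(2)]] edge_pairD[OF graph that(1)] by blast
    have R: "R i t \<notin> \<real>\<^sub>\<ge>\<^sub>0" if "{v, i} \<in> E" "a \<noteq> i" "t \<in> {0..1}" for i t
      unfolding R_def using edge_directions_differ[OF graph planar e(1)] that by blast
    have R_cont: "continuous_on {0..1} (R i)" if "{v, i} \<in> E" for i
      unfolding R_def using edge_pairD[OF graph that] edge_pairD[OF graph e(1)] ne[OF e(1)]
      by (intro continuous_intros cont) auto
    have A_cont: "continuous_on {0..1} (\<lambda>t. Arg2pi (R i t))" if "{v, i} \<in> E" "a \<noteq> i" for i
      by (rule continuous_on_compose2[of "- \<real>\<^sub>\<ge>\<^sub>0" Arg2pi])
        (use R[OF that] R_cont[OF that(1)] continuous_at_Arg2pi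
          in \<open>auto intro!: continuous_at_imp_continuous_on\<close>)
    have "Arg2pi (R b t) \<noteq> Arg2pi (R c t)" if t: "t \<in> {0..1}" for t
    proof
      assume "Arg2pi (R b t) = Arg2pi (R c t)"
      then obtain k where k: "k > 0" "R b t = of_real k * R c t"
        using Arg2pi_eq_iff R[OF e(2,4) t] R[OF e(3,5) t] by (metis nonneg_Reals_zero_I)
      then have "(G t b - G t v) / (G t c - G t v) = of_real k"
        using ne[OF e(1) t] ne[OF e(3) t] by (simp add: R_def field_simps)
      then show False
        using edge_directions_differ[OF graph planar[OF t] e(3,2)] e(6) k(1) by simp
    qed
    then have "Arg2pi (R b 0) - Arg2pi (R c 0) < 0 \<longleftrightarrow> Arg2pi (R b 1) - Arg2pi (R c 1) < 0"
      by (intro same_sign_endpoints[of "\<lambda>t. Arg2pi (R b t) - Arg2pi (R c t)"] continuous_intros A_cont e) simp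
    then show ?thesis
      by (simp add: R_def)
  qed
  then show ?thesis
    unfolding circular_order_def by (intro Collect_cong) (simp add: split_beta, blast)
qed

section \<open>Crossing segments\<close>

text \<open>This is the cross product of \<open>b - a\<close> and \<open>c - a\<close>, twice the
  signed area of the triangle; it is positive for a counterclockwise triangle.\<close>

definition orientation :: "complex \<Rightarrow> complex \<Rightarrow> complex \<Rightarrow> real" where
  "orientation a b c = Im (cnj (b - a) * (c - a))"

lemma orientation_eq_0_iff:
  assumes "a \<noteq> b"
  shows "orientation a b c = 0 \<longleftrightarrow> (\<exists>k. c = a + of_real k * (b - a))"
proof
  assume "orientation a b c = 0"
  then have "cnj (b - a) * (c - a) \<in> \<real>"
    by (simp add: orientation_def complex_is_Real_iff)
  then obtain r where "cnj (b - a) * (c - a) = of_real r"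
    by (auto elim: Reals_cases)
  then have "(b - a) * cnj (b - a) * (c - a) = of_real r * (b - a)"
    by (simp add: mult.commute mult.left_commute)
  then have "of_real ((norm (b - a))\<^sup>2) * (c - a) = of_real r * (b - a)"
    by (simp only: complex_norm_square)
  then have "c = a + of_real (r / (norm (b - a))\<^sup>2) * (b - a)"
    using assms by (simp add: field_simps)
  then show "\<exists>k. c = a + of_real k * (b - a)" ..
next
  assume "\<exists>k. c = a + of_real k * (b - a)"
  then obtain k where "c = a + of_real k * (b - a)"
    by blast
  then have eq: "c - a = of_real k * (b - a)"
    by simp
  have "cnj (b - a) * (c - a) = of_real (k * (norm (b - a))\<^sup>2)"
    by (simp only: eq of_real_mult complex_norm_square mult_ac)
  then show "orientation a b c = 0"
    by (simp only: orientation_def Im_complex_of_real)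
qed

text \<open>The orientation relative to \<open>a\<close>, \<open>b\<close> is affine along
  \<open>c d\<close> and vanishes at \<open>x\<close>, so its end values have opposite signs unless
  both vanish. In that collinear case \<open>c\<close> and \<open>d\<close> lie beyond opposite ends
  of \<open>a b\<close>, which puts \<open>a\<close> on \<open>c d\<close>.\<close>

lemma segments_cross_half:
  assumes x: "x \<in> closed_segment a b" "x \<in> closed_segment c d"
    and "c \<notin> closed_segment a b" "d \<notin> closed_segment a b" "a \<notin> closed_segment c d" "b \<notin> closed_segment c d"
  shows "orientation a b c * orientation a b d < 0"
proof -
  obtain s where s: "0 \<le> s" "s \<le> 1" "x = (1 - s) *\<^sub>R a + s *\<^sub>R b"
    using x(1) by (auto simp: in_segment)
  obtain r where r: "0 \<le> r" "r \<le> 1" "x = (1 - r) *\<^sub>R c + r *\<^sub>R d"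
    using x(2) by (auto simp: in_segment)
  have "r \<noteq> 0" "r \<noteq> 1" "s \<noteq> 0" "s \<noteq> 1"
    using s r x assms by auto
  then have r': "0 < r" "r < 1" and s': "0 < s" "s < 1"
    using r s by auto
  have "a \<noteq> b"
    using x assms by auto
  have "(1 - r) * orientation a b c + r * orientation a b d = orientation a b x"
    unfolding r(3) orientation_def by (simp add: algebra_simps)
  also have "\<dots> = 0"
    unfolding s(3) orientation_def by (simp add: algebra_simps)
  finally have sum: "(1 - r) * orientation a b c = - (r * orientation a b d)"
    by simp
  have "orientation a b c \<noteq> 0"
  proof
    assume c0: "orientation a b c = 0"
    then have "orientation a b d = 0"
      using sum r' by simp
    then obtain k l where k: "c = a + of_real k * (b - a)" and l: "d = a + of_real l * (b - a)"
      using c0 orientation_eq_0_iff[OF \<open>a \<noteq> b\<close>] by blast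
    have "of_real s * (b - a) = of_real ((1 - r) * k + r * l) * (b - a)"
      using s(3) r(3) k l by (simp add: scaleR_conv_of_real algebra_simps)
    then have skl: "s = (1 - r) * k + r * l"
      using \<open>a \<noteq> b\<close> by (simp only: mult_cancel_right of_real_eq_iff) simp
    have out: "j < 0 \<or> j > 1" if "a + of_real j * (b - a) \<notin> closed_segment a b" for j
    proof (rule ccontr)
      assume "\<not> ?thesis"
      moreover have "a + of_real j * (b - a) = (1 - j) *\<^sub>R a + j *\<^sub>R b"
        by (simp add: scaleR_conv_of_real algebra_simps)
      ultimately show False
        using that unfolding in_segment by (metis not_le)
    qed
    have "k < 0 \<and> l > 1 \<or> k > 1 \<and> l < 0"
    proof -
      have "\<not> (k < 0 \<and> l < 0)"
        using skl s' r' mult_pos_neg[of "1 - r" k] mult_pos_neg[of r l] by auto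
      moreover have "\<not> (k > 1 \<and> l > 1)"
      proof
        assume "k > 1 \<and> l > 1"
        then have "(1 - r) * 1 < (1 - r) * k" "r * 1 < r * l"
          using r' by (intro mult_strict_left_mono; simp)+
        then have "(1 - r) * 1 + r * 1 < s"
          unfolding skl by (rule add_strict_mono)
        then show False
          using s' by simp
      qed
      ultimately show ?thesis
        using out[of k] out[of l] assms(3,4) k l by auto
    qed
    \<comment> \<open>\<open>k / (k - l)\<close> is the parameter at which the segment from
      \<open>c\<close> to \<open>d\<close> passes through \<open>a\<close>: it solves
      \<open>k + j * (l - k) = 0\<close>.\<close>
    then have u: "0 \<le> k / (k - l)" "k / (k - l) \<le> 1" "k \<noteq> l"
      by (auto simp: divide_simps)
    have "(1 - j) *\<^sub>R c + j *\<^sub>R d = a + of_real (k + j * (l - k)) * (b - a)" for j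
      unfolding k l by (simp add: scaleR_conv_of_real algebra_simps)
    from this[of "k / (k - l)"]
    have "(1 - k / (k - l)) *\<^sub>R c + (k / (k - l)) *\<^sub>R d =
        a + of_real (k + (k / (k - l)) * (l - k)) * (b - a)" .
    also have "k + (k / (k - l)) * (l - k) = 0"
      using u by (simp add: field_simps)
    finally have "a \<in> closed_segment c d"
      using u unfolding in_segment by (intro exI[of _ "k / (k - l)"]) simp
    then show False
      using assms by blast
  qed
  then have pos: "(orientation a b c)\<^sup>2 > 0"
    by simp
  have "r * (orientation a b c * orientation a b d) = orientation a b c * (r * orientation a b d)"
    by simp
  also have "\<dots> = - (1 - r) * (orientation a b c)\<^sup>2"
  proof -
    have "r * orientation a b d = - ((1 - r) * orientation a b c)"
      using sum by simp
    then show ?thesis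
      by (simp only:) (simp add: power2_eq_square algebra_simps)
  qed
  also have "\<dots> < 0"
    using pos r' by (simp add: mult_neg_pos)
  finally show ?thesis
    using r' by (simp add: mult_less_0_iff)
qed

text \<open>Cramer's rule solves \<open>a + s (b - a) = c + r (d - c)\<close> with the parameters
  \<open>?s\<close> and \<open>?r\<close>; the sign conditions place both in the unit
  interval.\<close>

lemma segments_cross_if_orientations:
  assumes o1: "orientation a b c * orientation a b d < 0" and o2: "orientation c d a * orientation c d b < 0"
  shows "closed_segment a b \<inter> closed_segment c d \<noteq> {}"
proof -
  let ?D = "orientation c d a - orientation c d b"
  let ?s = "orientation c d a / ?D" and ?r = "- orientation a b c / ?D"
  have eq: "orientation a b c - orientation a b d = - ?D"
    by (simp add: orientation_def algebra_simps)
  have D: "?D \<noteq> 0"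
    using o2 by (auto simp: mult_less_0_iff)
  have s: "0 \<le> ?s" "?s \<le> 1"
    using o2 by (auto simp: mult_less_0_iff divide_simps)
  have "?r = orientation a b c / (orientation a b c - orientation a b d)"
    unfolding eq by (simp only: divide_minus_left divide_minus_right)
  moreover have "0 \<le> \<dots>" "\<dots> \<le> 1"
    using o1 by (auto simp: mult_less_0_iff divide_simps)
  ultimately have r: "0 \<le> ?r" "?r \<le> 1"
    by simp_all
  have cramer: "of_real (orientation c d a) * (b - a) + of_real (orientation a b c) * (d - c) = of_real ?D * (c - a)"
    by (simp add: complex_eq_iff orientation_def algebra_simps)
  have "of_real ?D * (of_real ?s * (b - a) - of_real ?r * (d - c)) = of_real ?D * (c - a)"
  proof -
    have "of_real ?D * (of_real ?s * (b - a) - of_real ?r * (d - c)) =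
        of_real (?D * ?s) * (b - a) - of_real (?D * ?r) * (d - c)"
      by (simp only: of_real_mult right_diff_distrib mult.assoc)
    also have "?D * ?s = orientation c d a"
      using D by simp
    also have "?D * ?r = - orientation a b c"
      using D by simp
    finally show ?thesis
      using cramer by simp
  qed
  then have "of_real ?s * (b - a) - of_real ?r * (d - c) = c - a"
    using D by (simp only: mult_cancel_left of_real_eq_0_iff) simp
  then have "(1 - ?s) *\<^sub>R a + ?s *\<^sub>R b = (1 - ?r) *\<^sub>R c + ?r *\<^sub>R d"
    by (simp only: scaleR_conv_of_real of_real_diff of_real_1) (simp only: algebra_simps mult_1)
  then have "(1 - ?s) *\<^sub>R a + ?s *\<^sub>R b \<in> closed_segment a b \<inter> closed_segment c d"
    using s r unfolding in_segment by (metis IntI in_segment(1) mem_Collect_eq)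
  then show ?thesis
    by blast
qed

text \<open>Once no end lies on the other segment, crossing is expressed by strict inequalities,
  which makes it an open condition in time.\<close>

lemma segments_cross_iff:
  assumes "c \<notin> closed_segment a b" "d \<notin> closed_segment a b" "a \<notin> closed_segment c d" "b \<notin> closed_segment c d"
  shows "closed_segment a b \<inter> closed_segment c d \<noteq> {} \<longleftrightarrow>
    orientation a b c * orientation a b d < 0 \<and> orientation c d a * orientation c d b < 0"
  using segments_cross_if_orientations segments_cross_half[of _ a b c d] segments_cross_half[of _ c d a b] assms
  by blast

text \<open>A second common point would give both segments the same direction from \<open>a\<close>,
  and then the end of one would lie on the other.\<close>

lemma segments_common_endpoint:
  assumes "b \<notin> closed_segment a c" "c \<notin> closed_segment a (b::complex)"
  shows "closed_segment a b \<inter> closed_segment a c = {a}"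
proof -
  have "x = a" if x: "x \<in> closed_segment a b" "x \<in> closed_segment a c" for x
  proof (rule ccontr)
    assume "x \<noteq> a"
    obtain s where s: "0 \<le> s" "s \<le> 1" "x - a = s *\<^sub>R (b - a)"
      using x(1) by (auto simp: in_segment algebra_simps)
    obtain r where r: "0 \<le> r" "r \<le> 1" "x - a = r *\<^sub>R (c - a)"
      using x(2) by (auto simp: in_segment algebra_simps)
    have sr: "0 < s" "0 < r"
      using s r \<open>x \<noteq> a\<close> by (auto simp: order_less_le)
    have in_seg: "q \<in> closed_segment a p" if "j *\<^sub>R (p - a) = k *\<^sub>R (q - a)" "0 < j" "j \<le> k" for p q :: complex and j k
    proof -
      have "q - a = (1 / k) *\<^sub>R (k *\<^sub>R (q - a))"
        using that by simp
      also have "\<dots> = (j / k) *\<^sub>R (p - a)"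
        using that(1) by (metis divide_inverse mult.commute mult_1 scaleR_scaleR)
      finally have "q = (1 - j / k) *\<^sub>R a + (j / k) *\<^sub>R p"
        by (simp add: algebra_simps)
      then show ?thesis
        using that unfolding in_segment by (intro exI[of _ "j / k"]) auto
    qed
    show False
      using in_seg[of s b r c] in_seg[of r c s b] s r sr assms by (metis linear)
  qed
  then show ?thesis
    by auto
qed

section \<open>Planarity during a vertex motion\<close>

text \<open>The set \<open>T\<close> of crossing times is relatively open by
  \<open>segments_cross_iff\<close> and closed as the projection of the compact set \<open>K\<close>
  of coincidences. As \<open>{0..1}\<close> is connected and 0 is not in \<open>T\<close>, it is
  empty.\<close>

lemma (in vertex_motion) crossing_invariant:
  assumes V: "a \<in> V" "b \<in> V" "c \<in> V" "d \<in> V"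
    and avoid: "\<And>t. t \<in> {0..1} \<Longrightarrow> G t c \<notin> closed_segment (G t a) (G t b) \<and> G t d \<notin> closed_segment (G t a) (G t b)
      \<and> G t a \<notin> closed_segment (G t c) (G t d) \<and> G t b \<notin> closed_segment (G t c) (G t d)"
    and start: "closed_segment (G 0 a) (G 0 b) \<inter> closed_segment (G 0 c) (G 0 d) = {}"
    and t: "t \<in> {0..1}"
  shows "closed_segment (G t a) (G t b) \<inter> closed_segment (G t c) (G t d) = {}"
proof -
  define T where "T = {t \<in> {0..1}. closed_segment (G t a) (G t b) \<inter> closed_segment (G t c) (G t d) \<noteq> {}}"
  define g where "g = (\<lambda>t. (orientation (G t a) (G t b) (G t c) * orientation (G t a) (G t b) (G t d),
    orientation (G t c) (G t d) (G t a) * orientation (G t c) (G t d) (G t b)))"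
  have "continuous_on {0..1} g"
    unfolding g_def orientation_def by (intro continuous_intros cont V)
  moreover have "t \<in> T \<longleftrightarrow> t \<in> {0..1} \<and> g t \<in> {..<0} \<times> {..<0}" for t
    using segments_cross_iff[of "G t c" "G t a" "G t b" "G t d"] avoid[of t] by (auto simp only: T_def g_def)
  then have "T = {0..1} \<inter> g -` ({..<0} \<times> {..<0})"
    by (simp only: set_eq_iff Int_iff vimage_eq) simp
  ultimately have "openin (top_of_set {0..1}) T"
    by (simp add: continuous_openin_preimage_gen open_Times)
  moreover have "closedin (top_of_set {0..1}) T"
  proof -
    define P where "P = (\<lambda>z. edge_point (G (fst z)) a b (fst (snd z)) - edge_point (G (fst z)) c d (snd (snd z)))"
    define K where "K = {z \<in> {0..1} \<times> ({0..1} \<times> {0..1}). P z = 0}"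
    have "continuous_on ({0..1} \<times> ({0..1} \<times> {0..1})) P"
      unfolding P_def by (intro continuous_intros continuous_on_edge_point cont_fst V)
    then have "closed K"
      unfolding K_def by (intro continuous_closed_preimage_constant closed_Times) auto
    moreover have "K \<subseteq> {0..1} \<times> ({0..1} \<times> {0..1})"
      by (auto simp: K_def)
    ultimately have "compact K"
      by (metis compact_Icc compact_Times compact_Int_closed inf.absorb2)
    then have "compact (fst ` K)"
      by (intro compact_continuous_image continuous_intros)
    moreover have "T = fst ` K"
    proof (intro set_eqI iffI)
      fix t assume "t \<in> T"
      then obtain x where "t \<in> {0..1}" "x \<in> edge_point (G t) a b ` {0..1}" "x \<in> edge_point (G t) c d ` {0..1}"
        unfolding T_def edge_segment_eq_closed_segment[symmetric] edge_segment_pair by blast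
      then obtain s r where "(t, s, r) \<in> K"
        by (auto simp: K_def P_def)
      then show "t \<in> fst ` K"
        by force
    next
      fix t assume "t \<in> fst ` K"
      then obtain s r where "t \<in> {0..1}" "s \<in> {0..1}" "r \<in> {0..1}" "edge_point (G t) a b s = edge_point (G t) c d r"
        by (auto simp: K_def P_def)
      then show "t \<in> T"
        unfolding T_def edge_segment_eq_closed_segment[symmetric] edge_segment_pair by blast
    qed
    moreover have "T \<subseteq> {0..1}"
      by (auto simp: T_def)
    ultimately show ?thesis
      by (simp add: closed_subset compact_imp_closed)
  qed
  ultimately have "T = {} \<or> T = {0..1}"
    using connected_clopen[of "{0..1::real}"] by auto
  moreover have "0 \<notin> T"
    using start by (simp add: T_def)
  ultimately have "T = {}"
    by auto
  then show ?thesis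
    using t by (auto simp: T_def)
qed

text \<open>
  Two edges can only start to cross by a vertex running into an edge, because a crossing of
  relative interiors is a condition that is both open and closed in time.
\<close>

lemma (in vertex_motion) planar_motionI:
  assumes start: "planar_straight_line_drawing V E (G 0)"
    and inj: "\<And>t. t \<in> {0..1} \<Longrightarrow> inj_on (G t) V"
    and avoid: "\<And>t e w. t \<in> {0..1} \<Longrightarrow> e \<in> E \<Longrightarrow> w \<in> V - e \<Longrightarrow> G t w \<notin> edge_segment (G t) e"
  shows "planar_motion V E G"
proof
  fix t :: real assume t: "t \<in> {0..1}"
  note seg = edge_segment_eq_closed_segment
  have avoid': "G \<tau> w \<notin> closed_segment (G \<tau> p) (G \<tau> q)"
    if "\<tau> \<in> {0..1}" "{p, q} \<in> E" "w \<in> V" "w \<notin> {p, q}" for \<tau> p q w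
    using avoid[of \<tau> "{p, q}" w] that by (simp only: seg) blast
  have "edge_segment (G t) e \<inter> edge_segment (G t) e' \<subseteq> G t ` (e \<inter> e')" if e: "e \<in> E" "e' \<in> E" "e \<noteq> e'" for e e'
  proof (cases "e \<inter> e' = {}")
    case True
    obtain a b where ab: "e = {a, b}" "a \<in> V" "b \<in> V"
      using edge_pair[OF graph e(1)] by metis
    obtain c d where cd: "e' = {c, d}" "c \<in> V" "d \<in> V"
      using edge_pair[OF graph e(2)] by metis
    have "closed_segment (G t a) (G t b) \<inter> closed_segment (G t c) (G t d) = {}"
    proof (rule crossing_invariant[OF ab(2,3) cd(2,3) _ _ t])
      show "closed_segment (G 0 a) (G 0 b) \<inter> closed_segment (G 0 c) (G 0 d) = {}"
        using planar_cells[OF graph start, of e e'] e True unfolding ab(1) cd(1) seg by (simp add: cells_def)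
      show "G \<tau> c \<notin> closed_segment (G \<tau> a) (G \<tau> b) \<and> G \<tau> d \<notin> closed_segment (G \<tau> a) (G \<tau> b)
          \<and> G \<tau> a \<notin> closed_segment (G \<tau> c) (G \<tau> d) \<and> G \<tau> b \<notin> closed_segment (G \<tau> c) (G \<tau> d)"
        if "\<tau> \<in> {0..1}" for \<tau>
        using e(1,2) True ab cd by (intro conjI avoid' that) auto
    qed
    then show ?thesis
      by (simp add: ab cd seg)
  next
    case False
    then obtain a where a: "a \<in> e" "a \<in> e'"
      by blast
    obtain b where b: "e = {a, b}" "b \<in> V"
      using edge_pair[OF graph e(1)] a(1) by (metis insertE insert_commute singletonD)
    obtain c where c: "e' = {a, c}" "c \<in> V"
      using edge_pair[OF graph e(2)] a(2) by (metis insertE insert_commute singletonD)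
    have "a \<noteq> b" "a \<noteq> c" "b \<noteq> c"
      using e b c edge_pairD(3)[OF graph, of a b] edge_pairD(3)[OF graph, of a c] by blast+
    then have "closed_segment (G t a) (G t b) \<inter> closed_segment (G t a) (G t c) = {G t a}"
      using e(1,2) b c by (intro segments_common_endpoint avoid' t) auto
    then show ?thesis
      using a by (simp add: b c seg)
  qed
  then show "planar_straight_line_drawing V E (G t)"
    using inj[OF t] avoid[OF t] by (simp add: planar_straight_line_drawing_def)
qed

lemma (in planar_motion) embedding_invariant: "embedding_of V E (G 0) = embedding_of V E (G 1)"
  by (simp add: embedding_of_def circular_order_invariant outer_vertices_invariant outer_sides_invariant)

section \<open>Lifting\<close>

text \<open>The point has positive barycentric coordinates \<open>\<alpha>\<close>,
  \<open>s\<close>, \<open>1 - s - \<alpha>\<close> at \<open>u\<close>, \<open>v\<close> and the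
  right-angled corner. The abscissa fixes \<open>s\<close> and the height fixes
  \<open>\<alpha>\<close>; lying above the edge means \<open>\<alpha> < 1 - s\<close>.\<close>

lemma lift_triangleI:
  assumes y: "Im (\<Gamma> u) < Im (\<Gamma> v)" and x: "Re (\<Gamma> u) \<noteq> Re (\<Gamma> v)" and s: "0 < s" "s < 1"
    and zx: "Re z = (1 - s) * Re (\<Gamma> u) + s * Re (\<Gamma> v)"
    and zy: "(1 - s) * Im (\<Gamma> u) + s * Im (\<Gamma> v) < Im z" "Im z < Im (\<Gamma> v)"
  shows "z \<in> lift_triangle \<Gamma> u v"
proof -
  let ?C = "Complex (Re (\<Gamma> u)) (Im (\<Gamma> v))"
  have "\<not> collinear {\<Gamma> u, \<Gamma> v, ?C}"
    unfolding collinear_3_expand using x y by (auto simp: complex_eq_iff algebra_simps)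
  note hull = interior_convex_hull_3_minimal[OF this]
  define \<alpha> where "\<alpha> = (Im (\<Gamma> v) - Im z) / (Im (\<Gamma> v) - Im (\<Gamma> u))"
  have \<alpha>: "0 < \<alpha>" "\<alpha> < 1 - s"
    using y zy by (auto simp: \<alpha>_def field_simps)
  have "Im z = \<alpha> * Im (\<Gamma> u) + (1 - \<alpha>) * Im (\<Gamma> v)"
    using y by (simp add: \<alpha>_def divide_simps) (simp add: algebra_simps)
  then have "\<alpha> *\<^sub>R \<Gamma> u + s *\<^sub>R \<Gamma> v + (1 - s - \<alpha>) *\<^sub>R ?C = z"
    using zx by (simp add: complex_eq_iff algebra_simps)
  then have "z \<in> interior (convex hull {\<Gamma> u, \<Gamma> v, ?C})"
    using \<alpha> s by (subst hull, simp) (intro CollectI exI[of _ \<alpha>] exI[of _ s] exI[of _ "1 - s - \<alpha>"], simp)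
  then show ?thesis
    using y by (simp add: lift_triangle_def triangle_corner_def)
qed

text \<open>On the transformed edge, \<open>g (?y w)\<close> is a value on a chord of
  \<open>g\<close>. By strict convexity \<open>w\<close> was therefore above the edge before the
  transformation, and by monotonicity it was below the upper end.\<close>

lemma transformed_vertex_avoids_edge:
  assumes sg: "simple_graph V E" and lift: "liftable V E \<Gamma>" and conv: "strictly_convex g" and mono: "strict_mono g"
    and e: "e \<in> E" and w: "w \<in> V - e"
  shows "transformed_drawing g \<Gamma> w \<notin> edge_segment (transformed_drawing g \<Gamma>) e"
proof
  let ?x = "\<lambda>u. Re (\<Gamma> u)" and ?y = "\<lambda>u. Im (\<Gamma> u)"
  assume on: "transformed_drawing g \<Gamma> w \<in> edge_segment (transformed_drawing g \<Gamma>) e"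
  have pl: "planar_straight_line_drawing V E \<Gamma>"
    using lift by (simp add: liftable_def)
  then have avoid: "\<Gamma> w \<notin> edge_segment \<Gamma> e"
    using e w by (simp add: planar_straight_line_drawing_def)
  obtain u v where uv: "e = {u, v}" "u \<in> V" "v \<in> V" "?y u \<le> ?y v"
    using edge_pair[OF sg e] by (metis insert_commute linear)
  obtain s where s: "s \<in> {0..1}" and "transformed_drawing g \<Gamma> w = edge_point (transformed_drawing g \<Gamma>) u v s"
    using on by (auto simp: uv edge_segment_pair)
  then have x: "?x w = (1 - s) * ?x u + s * ?x v" and gy: "g (?y w) = (1 - s) * g (?y u) + s * g (?y v)"
    by (simp_all add: transformed_drawing_def edge_point_def complex_eq_iff)
  have off: "?y w \<noteq> (1 - s) * ?y u + s * ?y v"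
  proof
    assume "?y w = (1 - s) * ?y u + s * ?y v"
    then have "\<Gamma> w = edge_point \<Gamma> u v s"
      using x by (simp add: edge_point_def complex_eq_iff)
    then show False
      using avoid s by (simp add: uv edge_segment_pair)
  qed
  have inj: "p = q" if "g p = g q" for p q
    using mono that by (simp add: strict_mono_eq)
  have "s \<noteq> 0" "s \<noteq> 1"
    using off gy inj by auto
  then have s': "0 < s" "s < 1"
    using s by auto
  \<comment> \<open>A horizontal edge stays horizontal, so \<open>w\<close> would already have been
    on it.\<close>
  have "?y u \<noteq> ?y v"
  proof
    assume "?y u = ?y v"
    then show False
      using off gy inj[of "?y w" "?y v"] by (simp add: algebra_simps)
  qed
  then have less: "?y u < ?y v"
    using uv by simp
  have "g ((1 - s) * ?y u + s * ?y v) < g (?y w)"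
    using conv[unfolded strictly_convex_def, rule_format, of "1 - s" "?y u" "?y v"] s' less gy by simp
  then have above: "(1 - s) * ?y u + s * ?y v < ?y w"
    using mono by (simp add: strict_mono_less)
  have "(1 - s) * g (?y u) < (1 - s) * g (?y v)"
    using mono less s' by (simp add: strict_mono_less)
  then have "g (?y w) < g (?y v)"
    using gy by (simp add: algebra_simps)
  then have below: "?y w < ?y v"
    using mono by (simp add: strict_mono_less)
  show False
  proof (cases "?x u = ?x v")
    case True
    \<comment> \<open>A vertical edge has an empty triangle; here \<open>w\<close> lies on the
      original edge itself, at the parameter \<open>r\<close> read off from the heights.\<close>
    define r where "r = (?y w - ?y u) / (?y v - ?y u)"
    have "s * (?y v - ?y u) > 0"
      using s' less by simp
    then have "?y u < ?y w"
      using above by (simp add: algebra_simps)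
    then have "r \<in> {0..1}"
      using below less by (simp add: r_def)
    moreover have "r * (?y v - ?y u) = ?y w - ?y u"
      using less by (simp add: r_def)
    then have "\<Gamma> w = edge_point \<Gamma> u v r"
      using x True by (simp add: edge_point_def complex_eq_iff algebra_simps)
    ultimately show False
      using avoid by (auto simp: uv edge_segment_pair)
  next
    case False
    then have "\<Gamma> w \<in> lift_triangle \<Gamma> u v"
      using less s' x above below by (intro lift_triangleI)
    then show False
      using lift e w by (auto simp: liftable_def uv)
  qed
qed

section \<open>Interpolation between the identity and the lifting function\<close>

text \<open>The identity part is affine, so strictness comes from \<open>t * f y\<close> alone and
  requires \<open>0 < t\<close>.\<close>

lemma strictly_convex_interpolate:
  assumes "strictly_convex f" "0 < t" "t \<le> 1"
  shows "strictly_convex (\<lambda>y. (1 - t) * y + t * f y)"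
  unfolding strictly_convex_def
proof (intro allI impI)
  fix a b s :: real assume s: "0 < s \<and> s < 1 \<and> a \<noteq> b"
  then have "t * f (s * a + (1 - s) * b) < t * (s * f a + (1 - s) * f b)"
    using assms unfolding strictly_convex_def by (intro mult_strict_left_mono) auto
  then show "(1 - t) * (s * a + (1 - s) * b) + t * f (s * a + (1 - s) * b) <
      s * ((1 - t) * a + t * f a) + (1 - s) * ((1 - t) * b + t * f b)"
    by (simp add: algebra_simps)
qed

lemma strict_mono_interpolate:
  assumes "strict_mono f" "0 \<le> t" "t \<le> 1"
  shows "strict_mono (\<lambda>y. (1 - t) * y + t * f y :: real)"
proof (rule strict_monoI)
  fix a b :: real assume "a < b"
  then have "f a < f b"
    using assms(1) by (simp add: strict_mono_less)
  then show "(1 - t) * a + t * f a < (1 - t) * b + t * f b"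
    \<comment> \<open>For \<open>t < 1\<close> the identity part increases strictly; for
      \<open>t = 1\<close> only \<open>f\<close> remains.\<close>
    using \<open>a < b\<close> assms(2,3) by (cases "t = 1") (auto intro!: add_less_le_mono mult_left_mono)
qed

lemma transformed_drawing_inj:
  assumes "inj_on \<Gamma> V" "strict_mono g"
  shows "inj_on (transformed_drawing g \<Gamma>) V"
  using assms by (auto simp: inj_on_def transformed_drawing_def strict_mono_eq complex_eq_iff)

text \<open>Integrality of \<open>f\<close> is given on natural numbers only, and an integer height
  is a natural number exactly when it is nonnegative.\<close>

lemma grid_drawing_transformed:
  assumes "grid_drawing V \<Gamma>" "\<And>r. r \<in> \<nat> \<Longrightarrow> f r \<in> \<nat>" "\<And>u. u \<in> V \<Longrightarrow> 0 \<le> Im (\<Gamma> u)"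
  shows "grid_drawing V (transformed_drawing f \<Gamma>)"
  using assms Nats_subset_Ints unfolding grid_drawing_def transformed_drawing_def
  by (auto simp: Nats_altdef2)

text \<open>The grid claim is stated for nonnegative heights because a lifting function is under no
  integrality condition at negative integers.\<close>

theorem theorem2:
  fixes V :: "'v set" and E :: "'v set set" and \<E> :: "'v plane_embedding"
    and \<Gamma> :: "'v drawing" and f :: "real \<Rightarrow> real"
  assumes "planar_drawing_of_plane_graph V E \<E> \<Gamma>"
    and "grid_drawing V \<Gamma>"
    and "liftable V E \<Gamma>"
    and "lifting_function f"
  shows "planar_drawing_of_plane_graph V E \<E> (transformed_drawing f \<Gamma>)
    \<and> ((\<forall>u\<in>V. Im (\<Gamma> u) \<ge> 0) \<longrightarrow> grid_drawing V (transformed_drawing f \<Gamma>))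
    \<and> same_planar_embedding V E \<Gamma> (transformed_drawing f \<Gamma>)"
proof -
  define G where "G = (\<lambda>t. transformed_drawing (\<lambda>y. (1 - t) * y + t * f y) \<Gamma>)"
  have G0: "G 0 = \<Gamma>" and G1: "G 1 = transformed_drawing f \<Gamma>"
    by (simp_all add: G_def transformed_drawing_def)
  have sg: "simple_graph V E" and pl: "planar_straight_line_drawing V E \<Gamma>" and emb: "embedding_of V E \<Gamma> = \<E>"
    using assms(1) by (simp_all add: planar_drawing_of_plane_graph_def)
  have conv: "strictly_convex f" and mono: "strict_mono f" and nat: "\<And>r. r \<in> \<nat> \<Longrightarrow> f r \<in> \<nat>"
    using assms(4) by (simp_all add: lifting_function_def)
  interpret vertex_motion V E G
  proof
    show "continuous_on {0..1} (\<lambda>t. G t v)" for v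
      unfolding G_def transformed_drawing_def Complex_eq by (intro continuous_intros)
  qed (rule sg)
  interpret planar_motion V E G
  proof (rule planar_motionI)
    show "inj_on (G t) V" if "t \<in> {0..1}" for t
      unfolding G_def using pl strict_mono_interpolate[OF mono] that
      by (intro transformed_drawing_inj) (auto simp: planar_straight_line_drawing_def)
    show "G t w \<notin> edge_segment (G t) e" if "t \<in> {0..1}" "e \<in> E" "w \<in> V - e" for t e w
    \<comment> \<open>At time 0 the interpolated function is the identity, which is not strictly
      convex; there the planarity of \<open>\<Gamma>\<close> is used directly.\<close>
    proof (cases "t = 0")
      case True
      then show ?thesis
        using pl that by (simp add: G0 planar_straight_line_drawing_def)
    next
      case False
      then show ?thesis
        unfolding G_def using that strictly_convex_interpolate[OF conv] strict_mono_interpolate[OF mono]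
        by (intro transformed_vertex_avoids_edge[OF sg assms(3)]) auto
    qed
  qed (simp add: G0 pl)
  have "planar_straight_line_drawing V E (transformed_drawing f \<Gamma>)"
    using planar[of 1] by (simp add: G1)
  moreover have "embedding_of V E \<Gamma> = embedding_of V E (transformed_drawing f \<Gamma>)"
    using embedding_invariant by (simp add: G0 G1)
  ultimately show ?thesis
    using sg emb grid_drawing_transformed[OF assms(2) nat]
    by (simp add: planar_drawing_of_plane_graph_def same_planar_embedding_def)
qed

end
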